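(* Let $f_1,\ldots,f_n$ be elements of $k[x_1,\ldots,x_n]$ such that $k[f_1,\ldots,f_n]=k[x_1,\ldots,x_n]$, and let $\mathbf w=(w_1,\ldots,w_n)\in(\Gamma_{\ge0})^n$. If $k(f_1^{\mathbf w},\ldots,f_n^{\mathbf w})$ has transcendence degree $n-1$ over $k$, then $$\sum_{i=1}^n\deg_{\mathbf w}f_i\ \ge\ \Delta_{\mathbf f}^{\mathbf w}+\sum_{i=1}^nw_i-\max\{w_i\mid i=1,\ldots,n\},$$ where $\mathbf f=(f_1,\ldots,f_n)$.
   Context: $k$ is a field of characteristic zero, $k[\mathbf x]=k[x_1,\ldots,x_n]$ is the polynomial ring in $n\ge1$ variables, and $\Gamma$ is a totally ordered additive group (abelian, with order compatible with addition); $\Gamma_{\ge0}=\{\gamma\in\Gamma\mid\gamma\ge0\}$. For $\mathbf w=(w_1,\ldots,w_n)\in\Gamma^n$, the $\mathbf w$-weighted grading $k[\mathbf x]=\bigoplus_{\gamma\in\Gamma}k[\mathbf x]_\gamma$ is given by letting $k[\mathbf x]_\gamma$ be the $k$-span of the monomials $x_1^{a_1}\cdots x_n^{a_n}$ with $\sum_i a_iw_i=\gamma$. For $f=\sum_\gamma f_\gamma\neq0$ with $f_\gamma\in k[\mathbf x]_\gamma$, the $\mathbf w$-degree $\deg_{\mathbf w}f$ is the maximum of the $\gamma$ with $f_\gamma\ne0$, and $f^{\mathbf w}:=f_\delta$ with $\delta=\deg_{\mathbf w}f$. Definition of $\Delta_{\mathbf f}^{\mathbf w}$ (when $k(f_1^{\mathbf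 w},\ldots,f_n^{\mathbf w})$ has transcendence degree $n-1$ over $k$): let $\lambda_{\mathbf f}^{\mathbf w}:k[\mathbf x]\to k[\mathbf x]$ be the $k$-algebra homomorphism with $x_i\mapsto f_i^{\mathbf w}$ for $i=1,\ldots,n$. Its kernel is a prime ideal of height one, hence $\ker\lambda_{\mathbf f}^{\mathbf w}=Q\,k[\mathbf x]$ for some $Q\in k[\mathbf x]\setminus\{0\}$, unique up to multiplication by elements of $k\setminus\{0\}$. Then $\Delta_{\mathbf f}^{\mathbf w}\in\Gamma$ is the $\mathbf w_{\mathbf f}$-degree of $Q$, where $\mathbf w_{\mathbf f}=(\deg_{\mathbf w}f_1,\ldots,\deg_{\mathbf w}f_n)\in\Gamma^n$. *)

theory Defs
  imports
    Complex_Main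
    "HOL-Library.Cardinality"
    "HOL-Library.Poly_Mapping"
    "HOL-Computational_Algebra.Computational_Algebra"
begin

text \<open>
  Polynomials over \<open>'k\<close> in the variables \<open>'v\<close> are finitely supported maps from exponent vectors to
  coefficients, with the convolution product of \<^theory>\<open>HOL-Library.Poly_Mapping\<close>. For
  \<open>'n :: {finite, linorder}\<close> this is the polynomial ring in \<open>CARD('n)\<close> variables; the linear order on
  the index type is only there because the library's \<^class>\<open>idom\<close> instance asks for it.
\<close>

type_synonym ('v, 'k) mpoly = "('v \<Rightarrow>\<^sub>0 nat) \<Rightarrow>\<^sub>0 'k"

definition const :: "'k::zero \<Rightarrow> ('v, 'k) mpoly"
  where "const c = Poly_Mapping.single 0 c"

text \<open>Evaluation at the point \<open>g\<close>, with coefficients sent into the target ring by \<open>c\<close>.\<close>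

definition eval_mpoly :: "('k::zero \<Rightarrow> 'a::comm_ring_1) \<Rightarrow> ('v \<Rightarrow> 'a) \<Rightarrow> ('v, 'k) mpoly \<Rightarrow> 'a"
  where "eval_mpoly c g p =
    (\<Sum>a\<in>Poly_Mapping.keys p. c (Poly_Mapping.lookup p a) *
      (\<Prod>v\<in>Poly_Mapping.keys a. g v ^ Poly_Mapping.lookup a v))"

definition is_subalgebra :: "('v, 'k::comm_ring_1) mpoly set \<Rightarrow> bool"
  where "is_subalgebra A \<longleftrightarrow> (\<forall>c. const c \<in> A) \<and>
    (\<forall>p\<in>A. \<forall>q\<in>A. p + q \<in> A \<and> p * q \<in> A)"


subsection \<open>Weighted degree and leading form\<close>

text \<open>\<open>\<Sum>\<^sub>i a\<^sub>i w\<^sub>i\<close>; the inner sum is the multiple \<open>a\<^sub>i w\<^sub>i\<close> in the additive group \<open>'g\<close>.\<close>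

definition weight :: "('n::finite \<Rightarrow> 'g::comm_monoid_add) \<Rightarrow> ('n \<Rightarrow>\<^sub>0 nat) \<Rightarrow> 'g"
  where "weight w a = (\<Sum>i\<in>UNIV. \<Sum>_<Poly_Mapping.lookup a i. w i)"

definition component ::
    "('n::finite \<Rightarrow> 'g::comm_monoid_add) \<Rightarrow> 'g \<Rightarrow> ('n, 'k::zero) mpoly \<Rightarrow> ('n, 'k) mpoly"
  where "component w \<gamma> f = Poly_Mapping.mapp (\<lambda>a c. if weight w a = \<gamma> then c else 0) f"

lemma lookup_component:
  "Poly_Mapping.lookup (component w \<gamma> f) a =
    (if weight w a = \<gamma> then Poly_Mapping.lookup f a else 0)"
  by (simp add: component_def Poly_Mapping.lookup_mapp Poly_Mapping.in_keys_iff when_def)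

text \<open>Meaningful for \<open>f \<noteq> 0\<close> only: \<open>wdeg w 0\<close> is the unspecified maximum of the empty set.\<close>

definition wdeg ::
    "('n::finite \<Rightarrow> 'g::linordered_ab_group_add) \<Rightarrow> ('n, 'k::zero) mpoly \<Rightarrow> 'g"
  where "wdeg w f = Max {\<gamma>. component w \<gamma> f \<noteq> 0}"

definition lead_form ::
    "('n::finite \<Rightarrow> 'g::linordered_ab_group_add) \<Rightarrow> ('n, 'k::zero) mpoly \<Rightarrow> ('n, 'k) mpoly"
  where "lead_form w f = component w (wdeg w f) f"


subsection \<open>Transcendence degree inside the field of rational functions\<close>

type_synonym ('n, 'k) ratfun = "('n, 'k) mpoly fract"

definition rconst :: "'k::field \<Rightarrow> ('n::{finite,linorder}, 'k) ratfun"
  where "rconst c = to_fract (const c)"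

definition is_subfield :: "('n::{finite,linorder}, 'k::field) ratfun set \<Rightarrow> bool"
  where "is_subfield F \<longleftrightarrow> (\<forall>c. rconst c \<in> F) \<and>
    (\<forall>x\<in>F. \<forall>y\<in>F. x + y \<in> F \<and> x * y \<in> F \<and> inverse x \<in> F)"

text \<open>Here the elements of \<open>B\<close> themselves serve as names of the variables of \<open>p\<close>.\<close>

definition alg_indep :: "('n::{finite,linorder}, 'k::field) ratfun set \<Rightarrow> bool"
  where "alg_indep B \<longleftrightarrow>
    (\<forall>p :: (('n, 'k) ratfun, 'k) mpoly.
      (\<forall>a\<in>Poly_Mapping.keys p. Poly_Mapping.keys a \<subseteq> B) \<and>
        eval_mpoly rconst (\<lambda>x. x) p = 0 \<longrightarrow> p = 0)"

definition transcendence_basis ::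
    "('n::{finite,linorder}, 'k::field) ratfun set \<Rightarrow> ('n, 'k) ratfun set \<Rightarrow> bool"
  where "transcendence_basis K B \<longleftrightarrow> B \<subseteq> K \<and> alg_indep B \<and>
    (\<forall>x\<in>K - B. \<not> alg_indep (insert x B))"

definition has_trdeg :: "('n::{finite,linorder}, 'k::field) ratfun set \<Rightarrow> nat \<Rightarrow> bool"
  where "has_trdeg K d \<longleftrightarrow> (\<exists>B. transcendence_basis K B \<and> finite B \<and> card B = d)"


subsection \<open>The invariant \<open>\<Delta>\<close>\<close>

definition lead_hom ::
    "('n::finite \<Rightarrow> 'g::linordered_ab_group_add) \<Rightarrow> ('n \<Rightarrow> ('n, 'k::field) mpoly)
      \<Rightarrow> ('n, 'k) mpoly \<Rightarrow> ('n, 'k) mpoly"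
  where "lead_hom w f = eval_mpoly const (\<lambda>i. lead_form w (f i))"

text \<open>
  When the leading forms have transcendence degree \<open>CARD('n) - 1\<close>, the kernel is a nonzero
  principal ideal; its generator is unique up to a nonzero constant, which does not affect the degree.
\<close>

definition kernel_generator ::
    "('n::finite \<Rightarrow> 'g::linordered_ab_group_add) \<Rightarrow> ('n \<Rightarrow> ('n, 'k::field) mpoly)
      \<Rightarrow> ('n, 'k) mpoly"
  where "kernel_generator w f =
    (SOME Q. Q \<noteq> 0 \<and> {p. lead_hom w f p = 0} = {Q * p | p. True})"

definition Delta ::
    "('n::finite \<Rightarrow> 'g::linordered_ab_group_add) \<Rightarrow> ('n \<Rightarrow> ('n, 'k::field) mpoly) \<Rightarrow> 'g"
  where "Delta w f = wdeg (\<lambda>i. wdeg w (f i)) (kernel_generator w f)"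

end

theory Submission
  imports Defs "HOL-Analysis.Determinants"
begin

text \<open>
  Write \<open>d\<^sub>i\<close> for the degree of \<open>f\<^sub>i\<close>, \<open>M = \<Sum> d\<^sub>i - \<Sum> w\<^sub>i\<close>, \<open>\<phi>\<close> for the substitution
  \<open>x\<^sub>i \<mapsto> f\<^sub>i\<close>, which is surjective, \<open>\<lambda>\<close> for the substitution \<open>x\<^sub>i \<mapsto> f\<^sub>i\<^sup>w\<close> of the leading forms,
  \<open>Q\<close> for the generator of its kernel and \<open>\<Delta>\<close> for the degree of \<open>Q\<close> when \<open>x\<^sub>i\<close> has weight \<open>d\<^sub>i\<close>. The
  inequality says that \<open>\<Delta> - M\<close> is at most the largest weight. It comes from comparing two estimates
  for what a partial derivative does to degrees.

  An upper estimate. Replacing \<open>f\<^sub>i\<close> by \<open>\<phi> p\<close> multiplies the Jacobian determinant of \<open>f\<close> by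
  \<open>\<phi> (\<partial>\<^sub>i p)\<close>, and the determinant itself is a unit because the \<open>f\<^sub>i\<close> generate. As the Jacobian
  determinant of \<open>g\<^sub>1, \<dots>, g\<^sub>n\<close> has degree at most \<open>\<Sum> deg g\<^sub>i - \<Sum> w\<^sub>i\<close>, passing from \<open>p\<close> to \<open>\<partial>\<^sub>i p\<close>
  raises the degree of \<open>\<phi> p\<close> by at most \<open>M - d\<^sub>i\<close>: lemma \<open>deg_le_eval_pderiv_var\<close>.

  A lower estimate. Choose \<open>P\<^sub>j\<close> with \<open>\<phi> P\<^sub>j = x\<^sub>j\<close>. If every \<open>P\<^sub>j\<close> had degree at most \<open>w\<^sub>j\<close>, then its
  component of degree \<open>w\<^sub>j\<close> would be sent to \<open>x\<^sub>j\<close> by \<open>\<lambda>\<close>; the leading forms would then have an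
  invertible Jacobian matrix, which excludes the relation \<open>Q\<close>. So some \<open>P\<^sub>j\<close> has degree \<open>e > w\<^sub>j\<close>.
  Its leading form \<open>F\<close> must cancel under \<open>\<lambda>\<close>, so \<open>F = Q\<^sup>m R\<close> with \<open>m \<ge> 1\<close> and \<open>Q\<close> not dividing \<open>R\<close>.
  For \<open>i\<close> with \<open>\<partial>\<^sub>i Q \<noteq> 0\<close>, the \<open>m\<close>-fold derivative of \<open>F\<close> is congruent to \<open>m! (\<partial>\<^sub>i Q)\<^sup>m R\<close> modulo
  \<open>Q\<close>, and in characteristic zero this is not in the kernel. Hence \<open>\<phi>\<close> of the \<open>m\<close>-fold derivative
  of \<open>P\<^sub>j\<close> has degree exactly \<open>e - m d\<^sub>i\<close>.

  Together, \<open>e - m d\<^sub>i \<le> w\<^sub>j + m (M - d\<^sub>i)\<close>, that is \<open>e \<le> w\<^sub>j + m M\<close>. Since all \<open>d\<^sub>i\<close> are nonnegative,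
  \<open>m \<Delta> \<le> e\<close>. Therefore \<open>m (\<Delta> - M) \<le> w\<^sub>j\<close>, and \<open>\<Delta> - M \<le> w\<^sub>j\<close> because \<open>m \<ge> 1\<close> and \<open>w\<^sub>j \<ge> 0\<close>.

  It remains to see that the kernel of \<open>\<lambda>\<close> is principal and nonzero, as \<open>\<Delta>\<close> is the degree of a
  chosen generator. Lemma \<open>trdeg_relations\<close> extracts from the transcendence degree that the kernel
  is nonzero and contains no nonzero polynomial that avoids a certain variable \<open>x\<^sub>v\<close>; its heart is
  the dimension count \<open>card_alg_indep_le\<close>, which replaces the exchange theory of algebraic
  dependence. Lemma \<open>prime_ideal_principal\<close> shows that such a prime ideal is principal, by
  pseudo-division in \<open>x\<^sub>v\<close>. It uses that polynomials have prime factors, which is proved by adding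
  one variable at a time.
\<close>

section \<open>Polynomials as a free algebra\<close>

abbreviation keys where "keys \<equiv> Poly_Mapping.keys"
abbreviation lookup where "lookup \<equiv> Poly_Mapping.lookup"
abbreviation single where "single \<equiv> Poly_Mapping.single"

definition Var :: "'v \<Rightarrow> ('v, 'k::zero_neq_one) mpoly"
  where "Var v = single (single v 1) 1"

definition monomial_value :: "('v \<Rightarrow> 'a::comm_ring_1) \<Rightarrow> ('v \<Rightarrow>\<^sub>0 nat) \<Rightarrow> 'a"
  where "monomial_value g a = (\<Prod>v\<in>keys a. g v ^ lookup a v)"

lemma sum_of_monomials: "(\<Sum>a\<in>keys p. single a (lookup p a)) = p"
proof (rule poly_mapping_eqI)
  fix b
  have "lookup (\<Sum>a\<in>keys p. single a (lookup p a)) b = (\<Sum>a\<in>keys p. lookup p a when a = b)"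
    by (simp add: lookup_sum lookup_single)
  also have "\<dots> = lookup p b"
    by (simp add: when_def sum.delta in_keys_iff)
  finally show "lookup (\<Sum>a\<in>keys p. single a (lookup p a)) b = lookup p b" .
qed

lemma poly_mapping_induct [case_names zero single add]:
  fixes P :: "('a \<Rightarrow>\<^sub>0 'b::comm_monoid_add) \<Rightarrow> bool"
  assumes "P 0" "\<And>a c. P (single a c)" "\<And>p q. P p \<Longrightarrow> P q \<Longrightarrow> P (p + q)"
  shows "P p"
proof -
  have "P (\<Sum>a\<in>A. single a (lookup p a))" if "finite A" for A
    using that by induction (auto intro: assms)
  then show ?thesis
    by (metis finite_keys sum_of_monomials)
qed

lemma monomial_value_superset:
  assumes "finite S" "keys a \<subseteq> S"
  shows "monomial_value g a = (\<Prod>v\<in>S. g v ^ lookup a v)"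
  unfolding monomial_value_def
  using assms by (intro prod.mono_neutral_left) (auto simp: in_keys_iff)

lemma monomial_value_add: "monomial_value g (a + b) = monomial_value g a * monomial_value g b"
proof -
  let ?S = "keys a \<union> keys b"
  have "monomial_value g (a + b) = (\<Prod>v\<in>?S. g v ^ lookup (a + b) v)"
    by (rule monomial_value_superset) (auto simp: keys_add)
  also have "\<dots> = (\<Prod>v\<in>?S. g v ^ lookup a v) * (\<Prod>v\<in>?S. g v ^ lookup b v)"
    by (simp add: lookup_add power_add prod.distrib)
  finally show ?thesis
    using monomial_value_superset[of ?S a g] monomial_value_superset[of ?S b g] by simp
qed

lemma monomial_value_0 [simp]: "monomial_value g 0 = 1"
  by (simp add: monomial_value_def)

lemma monomial_value_single [simp]: "monomial_value g (single v n) = g v ^ n"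
  by (cases "n = 0") (simp_all add: monomial_value_def)

lemma eval_mpoly_alt:
  "eval_mpoly c g p = (\<Sum>a\<in>keys p. c (lookup p a) * monomial_value g a)"
  by (simp add: eval_mpoly_def monomial_value_def)

lemma const_0 [simp]: "const 0 = 0"
  and const_1 [simp]: "const 1 = 1"
  and const_add: "const (a + b) = const a + const b"
  and const_mult: "const (a * b) = const a * const b"
  by (simp_all add: const_def single_add mult_single)

lemma const_eq_0_iff [simp]: "const c = 0 \<longleftrightarrow> c = 0"
  by (metis const_def lookup_single_eq lookup_zero single_zero)

lemma single_eq_const_mult_monomial: "single a c = const c * single a (1::'k::comm_ring_1)"
  by (simp add: const_def mult_single)

lemma Var_power: "Var v ^ n = single (single v n) (1::'k::comm_ring_1)"
  by (induction n) (simp_all add: Var_def mult_single single_add[symmetric])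

lemma const_if_keys:
  assumes "keys p \<subseteq> {0}"
  shows "p = const (lookup p 0)"
  using assms by (intro poly_mapping_eqI) (auto simp: const_def lookup_single when_def in_keys_iff)

locale coeff_hom =
  fixes c :: "'k::comm_ring_1 \<Rightarrow> 'a::comm_ring_1"
  assumes hom_0 [simp]: "c 0 = 0" and hom_1 [simp]: "c 1 = 1"
    and hom_add: "c (x + y) = c x + c y" and hom_mult: "c (x * y) = c x * c y"
begin

lemma eval_0 [simp]: "eval_mpoly c g 0 = 0"
  by (simp add: eval_mpoly_alt)

lemma eval_single: "eval_mpoly c g (single a x) = c x * monomial_value g a"
  by (cases "x = 0") (simp_all add: eval_mpoly_alt)

lemma eval_const [simp]: "eval_mpoly c g (const x) = c x"
  by (simp add: const_def eval_single)

lemma eval_1 [simp]: "eval_mpoly c g 1 = 1"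
  by (metis const_1 eval_const hom_1)

lemma eval_Var [simp]: "eval_mpoly c g (Var v) = g v"
  by (simp add: Var_def eval_single)

lemma eval_add: "eval_mpoly c g (p + q) = eval_mpoly c g p + eval_mpoly c g q"
  unfolding eval_mpoly_alt
  by (rule setsum_keys_plus_distrib) (simp_all add: hom_add distrib_right)

lemma eval_mult: "eval_mpoly c g (p * q) = eval_mpoly c g p * eval_mpoly c g q"
proof (induction p rule: poly_mapping_induct)
  case (single a x)
  show ?case
    by (induction q rule: poly_mapping_induct)
      (simp_all add: eval_single mult_single monomial_value_add hom_mult eval_add distrib_left distrib_right
        mult.assoc mult.left_commute)
qed (simp_all add: eval_add distrib_right)

lemma eval_uminus: "eval_mpoly c g (- p) = - eval_mpoly c g p"
  by (metis add.right_inverse add_eq_0_iff2 eval_0 eval_add)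

lemma eval_diff: "eval_mpoly c g (p - q) = eval_mpoly c g p - eval_mpoly c g q"
  by (metis diff_conv_add_uminus eval_add eval_uminus)

lemma eval_power: "eval_mpoly c g (p ^ n) = eval_mpoly c g p ^ n"
  by (induction n) (simp_all add: eval_mult)

lemma eval_sum: "eval_mpoly c g (sum p A) = (\<Sum>i\<in>A. eval_mpoly c g (p i))"
  by (induction A rule: infinite_finite_induct) (simp_all add: eval_add)

end

interpretation const: coeff_hom "const :: 'k::comm_ring_1 \<Rightarrow> ('v, 'k) mpoly"
  by unfold_locales (simp_all add: const_add const_mult)

interpretation rconst: coeff_hom "rconst :: 'k::field \<Rightarrow> ('n::{finite,linorder}, 'k) ratfun"
  by unfold_locales (simp_all add: rconst_def const_add const_mult)

lemma single_in_generated: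
  assumes "\<And>c. P (const (c::'k::comm_ring_1))" "\<And>v. v \<in> keys a \<Longrightarrow> P (Var v)"
    "\<And>p q. P p \<Longrightarrow> P q \<Longrightarrow> P (p * q)"
  shows "P (single a c)"
proof -
  have pow: "P (Var v ^ n)" if "v \<in> keys a" for v n
    by (induction n) (use assms(1)[of 1] assms(2,3) that in auto)
  have "P (\<Prod>v\<in>A. Var v ^ lookup a v)" if "A \<subseteq> keys a" for A
    using finite_subset[OF that finite_keys] that
    by (induction A) (use assms(1)[of 1] assms(3) pow in auto)
  moreover have "(\<Prod>v\<in>A. Var v ^ lookup a v) = single (\<Sum>v\<in>A. single v (lookup a v)) (1::'k)"
    if "finite A" for A
    using that by induction (simp_all add: Var_power mult_single)
  ultimately have "P (single a 1)"
    by (metis finite_keys order_refl sum_of_monomials)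
  then show ?thesis
    by (metis assms(1,3) single_eq_const_mult_monomial)
qed

lemma mpoly_induct [case_names const Var add mult]:
  assumes "\<And>c. P (const (c::'k::comm_ring_1))" "\<And>v. P (Var v)"
    "\<And>p q. P p \<Longrightarrow> P q \<Longrightarrow> P (p + q)" "\<And>p q. P p \<Longrightarrow> P q \<Longrightarrow> P (p * q)"
  shows "P p"
proof (induction p rule: poly_mapping_induct)
  case zero
  show ?case using assms(1)[of 0] by simp
qed (simp_all add: single_in_generated assms)

lemma (in coeff_hom) eval_substitute:
  "eval_mpoly c g (eval_mpoly const h p) = eval_mpoly c (\<lambda>v. eval_mpoly c g (h v)) p"
  by (induction p rule: mpoly_induct)
    (simp_all add: eval_add eval_mult const.eval_add const.eval_mult)

lemma eval_Var_id: "eval_mpoly const Var p = p"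
  by (induction p rule: mpoly_induct) (simp_all add: const.eval_add const.eval_mult)

lemma eval_mpoly_cong:
  assumes "\<And>a v. a \<in> keys p \<Longrightarrow> v \<in> keys a \<Longrightarrow> g v = h v"
  shows "eval_mpoly c g p = eval_mpoly c h p"
  unfolding eval_mpoly_def
  by (intro sum.cong arg_cong2[where f="(*)"] prod.cong) (simp_all add: assms)

section \<open>Partial derivatives\<close>

definition pderiv_var :: "'v \<Rightarrow> ('v, 'k::comm_ring_1) mpoly \<Rightarrow> ('v, 'k) mpoly"
  where "pderiv_var i p =
    (\<Sum>a\<in>keys p. single (a - single i 1) (of_nat (lookup a i) * lookup p a))"

lemma pderiv_var_single:
  "pderiv_var i (single a c) = single (a - single i 1) (of_nat (lookup a i) * c)"
  by (cases "c = 0") (simp_all add: pderiv_var_def)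

lemma pderiv_var_add: "pderiv_var i (p + q) = pderiv_var i p + pderiv_var i q"
  unfolding pderiv_var_def
  by (rule setsum_keys_plus_distrib) (simp_all add: single_add[symmetric] distrib_left)

lemma pderiv_var_0 [simp]: "pderiv_var i 0 = 0"
  by (simp add: pderiv_var_def)

lemma lookup_pderiv_var:
  "lookup (pderiv_var i p) a = of_nat (Suc (lookup a i)) * lookup p (a + single i 1)"
proof (induction p rule: poly_mapping_induct)
  case (single b c)
  have *: "b - single i 1 = a \<longleftrightarrow> b = a + single i 1" if "lookup b i \<noteq> 0"
    using that by (auto simp: poly_mapping_eq_iff fun_eq_iff lookup_add lookup_minus lookup_single when_def)
  have "lookup b i = 0 \<Longrightarrow> b \<noteq> a + single i 1"
    by (metis add_is_0 lookup_add lookup_single_eq one_neq_zero)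
  then show ?case
    using * by (cases "lookup b i = 0")
      (auto simp: pderiv_var_single lookup_single when_def lookup_add)
qed (simp_all add: pderiv_var_add lookup_add distrib_left)

lemma pderiv_var_mult:
  "pderiv_var i (p * q) = pderiv_var i p * q + p * pderiv_var i q"
  for p q :: "('v, 'k::comm_ring_1) mpoly"
proof (induction p rule: poly_mapping_induct)
  case (single a x)
  show ?case
  proof (induction q rule: poly_mapping_induct)
    case (single b y)
    have "a + b - single i 1 = a - single i 1 + b" if "lookup a i \<noteq> 0"
    proof (rule poly_mapping_eqI)
      show "lookup (a + b - single i 1) j = lookup (a - single i 1 + b) j" for j
        using that by (cases "i = j") (simp_all add: lookup_add lookup_minus lookup_single)
    qed
    then have a: "single (a + b - single i 1) (of_nat (lookup a i) * z) =
        single (a - single i 1 + b) (of_nat (lookup a i) * (z::'k))" for z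
      by (cases "lookup a i = 0") simp_all
    have "a + b - single i 1 = a + (b - single i 1)" if "lookup b i \<noteq> 0"
    proof (rule poly_mapping_eqI)
      show "lookup (a + b - single i 1) j = lookup (a + (b - single i 1)) j" for j
        using that by (cases "i = j") (simp_all add: lookup_add lookup_minus lookup_single)
    qed
    then have b: "single (a + b - single i 1) (of_nat (lookup b i) * z) =
        single (a + (b - single i 1)) (of_nat (lookup b i) * (z::'k))" for z
      by (cases "lookup b i = 0") simp_all
    show ?case
      by (simp add: pderiv_var_single mult_single lookup_add distrib_right single_add
          a[unfolded One_nat_def] b[unfolded One_nat_def] mult.assoc
          mult.left_commute[of x])
  qed (simp_all add: pderiv_var_add algebra_simps)
qed (simp_all add: pderiv_var_add algebra_simps)

lemma pderiv_var_const [simp]: "pderiv_var i (const c) = 0"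
  by (simp add: const_def pderiv_var_single)

lemma pderiv_var_Var: "pderiv_var i (Var j) = (if i = j then 1 else 0)"
  by (simp add: Var_def pderiv_var_single lookup_single when_def)

text \<open>
  The chain rule. Both sides are additive in \<open>p\<close>, obey the same product rule and agree on
  constants and variables, which is all that the induction needs.
\<close>

lemma pderiv_var_eval:
  "pderiv_var i (eval_mpoly const g p) =
    (\<Sum>l\<in>UNIV. eval_mpoly const g (pderiv_var l p) * pderiv_var i (g l))"
  for g :: "'m::finite \<Rightarrow> ('v, 'k::comm_ring_1) mpoly"
proof (induction p rule: mpoly_induct)
  case (Var v)
  have "(\<Sum>l\<in>UNIV. eval_mpoly const g (pderiv_var l (Var v)) * pderiv_var i (g l)) =
      (\<Sum>l\<in>UNIV. if l = v then pderiv_var i (g l) else 0)"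
    by (rule sum.cong) (simp_all add: pderiv_var_Var)
  then show ?case by simp
qed (simp_all add: const.eval_add const.eval_mult pderiv_var_add pderiv_var_mult algebra_simps
    sum.distrib sum_distrib_left)

section \<open>Polynomials in some of the variables\<close>

definition polys_in :: "'v set \<Rightarrow> ('v, 'k::zero) mpoly set"
  where "polys_in S = {p. \<forall>a\<in>keys p. keys a \<subseteq> S}"

lemma polys_in_UNIV [simp]: "polys_in UNIV = UNIV"
  by (simp add: polys_in_def)

lemma polys_in_mono: "S \<subseteq> T \<Longrightarrow> polys_in S \<subseteq> polys_in T"
  by (auto simp: polys_in_def)

lemma polys_in_const [simp]: "const c \<in> polys_in S"
  by (simp add: polys_in_def const_def)

lemma polys_in_0 [simp]: "0 \<in> polys_in S"
  by (simp add: polys_in_def)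

lemma polys_in_1 [simp]: "1 \<in> polys_in S"
  by (metis const_1 polys_in_const)

lemma polys_in_Var: "v \<in> S \<Longrightarrow> Var v \<in> polys_in S"
  by (simp add: polys_in_def Var_def)

lemma polys_in_add: "p \<in> polys_in S \<Longrightarrow> q \<in> polys_in S \<Longrightarrow> p + q \<in> polys_in S"
  for p q :: "('v, 'k::comm_ring_1) mpoly"
  using keys_add[of p q] by (auto simp: polys_in_def)

lemma polys_in_uminus: "p \<in> polys_in S \<Longrightarrow> - p \<in> polys_in S"
  for p :: "('v, 'k::comm_ring_1) mpoly"
  by (auto simp: polys_in_def in_keys_iff)

lemma polys_in_diff: "p \<in> polys_in S \<Longrightarrow> q \<in> polys_in S \<Longrightarrow> p - q \<in> polys_in S"
  for p q :: "('v, 'k::comm_ring_1) mpoly"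
  by (metis diff_conv_add_uminus polys_in_add polys_in_uminus)

lemma polys_in_mult: "p \<in> polys_in S \<Longrightarrow> q \<in> polys_in S \<Longrightarrow> p * q \<in> polys_in S"
  for p q :: "('v, 'k::comm_ring_1) mpoly"
  unfolding polys_in_def
proof clarify
  fix c v assume *: "\<forall>a\<in>keys p. keys a \<subseteq> S" "\<forall>a\<in>keys q. keys a \<subseteq> S"
    and "c \<in> keys (p * q)" "v \<in> keys c"
  then obtain a b where "a \<in> keys p" "b \<in> keys q" "v \<in> keys (a + b)"
    using keys_mult[of p q] by blast
  with * show "v \<in> S"
    using keys_add[of a b] by blast
qed

lemma polys_in_power: "p \<in> polys_in S \<Longrightarrow> p ^ n \<in> polys_in S"
  for p :: "('v, 'k::comm_ring_1) mpoly"
  by (induction n) (simp_all add: polys_in_mult)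

lemma polys_in_component: "p \<in> polys_in S \<Longrightarrow> component w \<gamma> p \<in> polys_in S"
  unfolding polys_in_def
proof clarify
  fix a v assume *: "\<forall>a\<in>keys p. keys a \<subseteq> S" and "a \<in> keys (component w \<gamma> p)" "v \<in> keys a"
  then have "a \<in> keys p"
    by (auto simp: in_keys_iff lookup_component split: if_splits)
  with * \<open>v \<in> keys a\<close> show "v \<in> S" by blast
qed

lemma polys_in_sum: "(\<And>i. i \<in> A \<Longrightarrow> p i \<in> polys_in S) \<Longrightarrow> sum p A \<in> polys_in S"
  for p :: "'i \<Rightarrow> ('v, 'k::comm_ring_1) mpoly"
  by (induction A rule: infinite_finite_induct) (simp_all add: polys_in_add)

lemma polys_in_single: "keys a \<subseteq> S \<Longrightarrow> single a c \<in> polys_in S"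
  by (simp add: polys_in_def)

lemma polys_in_induct [consumes 1, case_names const Var add mult]:
  assumes "p \<in> polys_in S"
    and "\<And>c. P (const (c::'k::comm_ring_1))" "\<And>v. v \<in> S \<Longrightarrow> P (Var v)"
    "\<And>p q. P p \<Longrightarrow> P q \<Longrightarrow> P (p + q)" "\<And>p q. P p \<Longrightarrow> P q \<Longrightarrow> P (p * q)"
  shows "P p"
proof -
  have P0: "P 0" using assms(2)[of 0] by simp
  have "P (\<Sum>a\<in>A. single a (lookup p a))" if "A \<subseteq> keys p" for A
    using finite_subset[OF that finite_keys] that
  proof (induction A)
    case (insert a A)
    moreover have "keys a \<subseteq> S"
      using insert.prems assms(1) unfolding polys_in_def by blast
    then have "P (single a (lookup p a))"
      by (intro single_in_generated[of P] assms(2,3,5)) blast+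
    ultimately show ?case using assms(4) by simp
  qed (use P0 in simp)
  then show ?thesis by (metis order_refl sum_of_monomials)
qed

lemma polys_in_eval:
  assumes "p \<in> polys_in S" "\<And>v. v \<in> S \<Longrightarrow> h v \<in> polys_in T"
  shows "eval_mpoly const h p \<in> polys_in T"
  using assms(1)
  by (induction rule: polys_in_induct)
    (simp_all add: assms(2) const.eval_add const.eval_mult polys_in_add polys_in_mult)

lemma eval_cong_polys_in:
  assumes "p \<in> polys_in S" "\<And>v. v \<in> S \<Longrightarrow> g v = h v"
  shows "eval_mpoly c g p = eval_mpoly c h p"
  using assms by (intro eval_mpoly_cong) (auto simp: polys_in_def)

section \<open>Weighted degrees\<close>

text \<open>
  An upper bound for the degree that the zero polynomial satisfies for every \<open>\<gamma>\<close>. Cancellation may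
  produce zero anywhere, and \<^const>\<open>wdeg\<close> is unspecified there.
\<close>

definition deg_le ::
    "('n::finite \<Rightarrow> 'g::linordered_ab_group_add) \<Rightarrow> 'g \<Rightarrow> ('n, 'k::zero) mpoly \<Rightarrow> bool"
  where "deg_le w \<gamma> p \<longleftrightarrow> (\<forall>a\<in>keys p. weight w a \<le> \<gamma>)"

lemma sum_const_add: "(\<Sum>_<(m::nat) + n. x) = (\<Sum>_<m. x) + (\<Sum>_<n. x)" for x :: "'g::comm_monoid_add"
  by (induction n) (simp_all add: add.assoc)

lemma weight_0 [simp]: "weight w 0 = 0"
  by (simp add: weight_def)

lemma weight_add: "weight w (a + b) = weight w a + weight w b"
  by (simp add: weight_def lookup_add sum_const_add sum.distrib)

lemma weight_single: "weight w (single i n) = (\<Sum>_<n. w i)"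
proof -
  have "weight w (single i n) = (\<Sum>j\<in>UNIV. if j = i then \<Sum>_<n. w i else 0)"
    unfolding weight_def by (rule sum.cong) (simp_all add: lookup_single when_def)
  then show ?thesis by simp
qed

lemma weight_single_1 [simp]: "weight w (single i (Suc 0)) = w i"
  by (simp add: weight_single)

lemma weight_nonneg: "(\<And>i. 0 \<le> w i) \<Longrightarrow> 0 \<le> weight w a"
  for w :: "'n::finite \<Rightarrow> 'g::linordered_ab_group_add"
  unfolding weight_def by (intro sum_nonneg) auto

lemma component_add: "component w \<gamma> (p + q) = component w \<gamma> p + component w \<gamma> q"
  for p :: "('n::finite, 'k::comm_monoid_add) mpoly"
  by (rule poly_mapping_eqI) (simp add: lookup_component lookup_add)

lemma component_0 [simp]: "component w \<gamma> 0 = 0"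
  by (rule poly_mapping_eqI) (simp add: lookup_component)

lemma component_sum: "component w \<gamma> (sum p A) = (\<Sum>i\<in>A. component w \<gamma> (p i))"
  for p :: "'i \<Rightarrow> ('n::finite, 'k::comm_monoid_add) mpoly"
  by (induction A rule: infinite_finite_induct) (simp_all add: component_add)

lemma component_single: "component w \<gamma> (single a c) = (if weight w a = \<gamma> then single a c else 0)"
  by (rule poly_mapping_eqI) (simp add: lookup_component lookup_single when_def)

lemma component_nonzero_iff: "component w \<gamma> p \<noteq> 0 \<longleftrightarrow> \<gamma> \<in> weight w ` keys p"
  by (auto simp: poly_mapping_eq_iff fun_eq_iff lookup_component in_keys_iff image_iff)

lemma wdeg_eq_Max: "wdeg w p = Max (weight w ` keys p)"
  by (simp add: wdeg_def component_nonzero_iff)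

lemma deg_le_wdeg: "deg_le w (wdeg w p) p"
  by (simp add: deg_le_def wdeg_eq_Max)

lemma deg_le_mono: "deg_le w \<gamma> p \<Longrightarrow> \<gamma> \<le> \<delta> \<Longrightarrow> deg_le w \<delta> p"
  by (force simp: deg_le_def)

lemma le_wdeg: "component w \<gamma> p \<noteq> 0 \<Longrightarrow> \<gamma> \<le> wdeg w p"
  by (simp add: component_nonzero_iff wdeg_eq_Max)

lemma wdeg_le_iff: "p \<noteq> 0 \<Longrightarrow> wdeg w p \<le> \<gamma> \<longleftrightarrow> deg_le w \<gamma> p"
  by (simp add: deg_le_def wdeg_eq_Max)

lemma lead_form_nonzero: "p \<noteq> 0 \<Longrightarrow> lead_form w p \<noteq> 0"
  unfolding lead_form_def component_nonzero_iff wdeg_eq_Max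
  by (intro Max_in) auto

lemma deg_le_component_imp_le: "deg_le w \<gamma> p \<Longrightarrow> component w \<delta> p \<noteq> 0 \<Longrightarrow> \<delta> \<le> \<gamma>"
  by (auto simp: component_nonzero_iff deg_le_def)

lemma wdeg_eqI: "deg_le w \<gamma> p \<Longrightarrow> component w \<gamma> p \<noteq> 0 \<Longrightarrow> wdeg w p = \<gamma>"
  by (metis antisym component_0 le_wdeg wdeg_le_iff)

lemma deg_le_0 [simp]: "deg_le w \<gamma> 0"
  by (simp add: deg_le_def)

lemma deg_le_single: "weight w a \<le> \<gamma> \<Longrightarrow> deg_le w \<gamma> (single a c)"
  by (simp add: deg_le_def)

lemma deg_le_const: "0 \<le> \<gamma> \<Longrightarrow> deg_le w \<gamma> (const c)"
  by (simp add: const_def deg_le_single)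

lemma deg_le_add: "deg_le w \<gamma> p \<Longrightarrow> deg_le w \<gamma> q \<Longrightarrow> deg_le w \<gamma> (p + q)"
  for p q :: "('n::finite, 'k::comm_monoid_add) mpoly"
  using keys_add[of p q] by (auto simp: deg_le_def)

lemma deg_le_uminus: "deg_le w \<gamma> (- p) \<longleftrightarrow> deg_le w \<gamma> p"
  for p :: "('n::finite, 'k::comm_ring_1) mpoly"
  by (simp add: deg_le_def in_keys_iff)

lemma deg_le_sum: "(\<And>i. i \<in> A \<Longrightarrow> deg_le w \<gamma> (p i)) \<Longrightarrow> deg_le w \<gamma> (sum p A)"
  for p :: "'i \<Rightarrow> ('n::finite, 'k::comm_monoid_add) mpoly"
  by (induction A rule: infinite_finite_induct) (simp_all add: deg_le_add)

lemma deg_le_mult: "deg_le w \<gamma> p \<Longrightarrow> deg_le w \<delta> q \<Longrightarrow> deg_le w (\<gamma> + \<delta>) (p * q)"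
  for p q :: "('n::finite, 'k::comm_ring_1) mpoly"
  using keys_mult[of p q] by (fastforce simp: deg_le_def weight_add intro: add_mono)

lemma deg_le_prod:
  "(\<And>i. i \<in> A \<Longrightarrow> deg_le w (d i) (p i)) \<Longrightarrow> deg_le w (sum d A) (prod p A)"
  for p :: "'i \<Rightarrow> ('n::finite, 'k::comm_ring_1) mpoly"
proof (induction A rule: infinite_finite_induct)
  case (insert i A)
  then show ?case by (simp add: deg_le_mult)
qed (use deg_le_const[of 0 w "1::'k"] in simp_all)

lemma component_eq_0: "deg_le w \<delta> p \<Longrightarrow> \<delta> < \<gamma> \<Longrightarrow> component w \<gamma> p = 0"
  using deg_le_component_imp_le leD by blast

text \<open>
  Monomials of weight at most \<open>\<gamma>\<close> and at most \<open>\<delta>\<close> multiply to one of weight \<open>\<gamma> + \<delta>\<close> only if both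
  bounds are attained. This is the source of all multiplicativity of degrees below.
\<close>

lemma component_mult:
  fixes p q :: "('n::finite, 'k::comm_ring_1) mpoly"
  assumes "deg_le w \<gamma> p" "deg_le w \<delta> q"
  shows "component w (\<gamma> + \<delta>) (p * q) = component w \<gamma> p * component w \<delta> q"
proof -
  have "p * q = (\<Sum>a\<in>keys p. \<Sum>b\<in>keys q. single (a + b) (lookup p a * lookup q b))"
    by (subst (1 2) sum_of_monomials[symmetric]) (simp only: sum_product mult_single)
  then have "component w (\<gamma> + \<delta>) (p * q) = (\<Sum>a\<in>keys p. \<Sum>b\<in>keys q.
      component w (\<gamma> + \<delta>) (single (a + b) (lookup p a * lookup q b)))"
    by (simp add: component_sum)
  also have "\<dots> = (\<Sum>a\<in>keys p. \<Sum>b\<in>keys q.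
      component w \<gamma> (single a (lookup p a)) * component w \<delta> (single b (lookup q b)))"
  proof (intro sum.cong refl)
    fix a b assume "a \<in> keys p" "b \<in> keys q"
    with assms have "weight w a \<le> \<gamma>" "weight w b \<le> \<delta>"
      by (auto simp: deg_le_def)
    then have "weight w a + weight w b = \<gamma> + \<delta> \<longleftrightarrow> weight w a = \<gamma> \<and> weight w b = \<delta>"
      by (metis add_less_le_mono add_le_less_mono less_irrefl order_le_less)
    then show "component w (\<gamma> + \<delta>) (single (a + b) (lookup p a * lookup q b)) =
        component w \<gamma> (single a (lookup p a)) * component w \<delta> (single b (lookup q b))"
      by (simp add: component_single weight_add mult_single)
  qed
  also have "\<dots> = component w \<gamma> (\<Sum>a\<in>keys p. single a (lookup p a)) *
      component w \<delta> (\<Sum>b\<in>keys q. single b (lookup q b))"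
    by (simp add: component_sum sum_product)
  finally show ?thesis by (simp only: sum_of_monomials)
qed

lemma wdeg_mult:
  fixes p q :: "('n::{finite,linorder}, 'k::idom) mpoly"
  assumes "p \<noteq> 0" "q \<noteq> 0"
  shows "wdeg w (p * q) = wdeg w p + wdeg w q"
proof (rule wdeg_eqI)
  show "deg_le w (wdeg w p + wdeg w q) (p * q)"
    by (intro deg_le_mult deg_le_wdeg)
  show "component w (wdeg w p + wdeg w q) (p * q) \<noteq> 0"
    using lead_form_nonzero[of p w] lead_form_nonzero[of q w] assms
    by (simp add: component_mult deg_le_wdeg lead_form_def)
qed

lemma wdeg_const: "c \<noteq> 0 \<Longrightarrow> wdeg w (const c) = 0"
  by (rule wdeg_eqI) (simp add: deg_le_const, simp add: component_nonzero_iff const_def)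

lemma wdeg_nonneg: "(\<And>i. 0 \<le> w i) \<Longrightarrow> p \<noteq> 0 \<Longrightarrow> 0 \<le> wdeg w p"
  by (auto simp: wdeg_eq_Max Max_ge_iff weight_nonneg simp flip: keys_eq_empty intro!: bexI)

text \<open>
  The degrees of a unit and of its inverse are nonnegative and cancel. Applied to a Jacobian
  determinant, this saves the argument that units are constants.
\<close>

lemma wdeg_unit:
  fixes p :: "('n::{finite,linorder}, 'k::idom) mpoly"
  assumes "\<And>i. 0 \<le> w i" "p dvd 1"
  shows "wdeg w p = 0"
proof -
  obtain q where q: "1 = p * q"
    using assms(2) by blast
  then have "p \<noteq> 0" "q \<noteq> 0" by auto
  then have "wdeg w p + wdeg w q = 0" "0 \<le> wdeg w p" "0 \<le> wdeg w q"
    using wdeg_mult[of p q w] q wdeg_const[of "1::'k" w] assms(1) by (auto simp: wdeg_nonneg)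
  then show ?thesis
    by (simp add: add_nonneg_eq_0_iff)
qed

lemma deg_le_pderiv_var:
  fixes p :: "('n::finite, 'k::comm_ring_1) mpoly"
  assumes "deg_le w \<gamma> p"
  shows "deg_le w (\<gamma> - w i) (pderiv_var i p)"
  unfolding deg_le_def
proof
  fix a assume "a \<in> keys (pderiv_var i p)"
  then have "a + single i 1 \<in> keys p"
    by (metis in_keys_iff lookup_pderiv_var mult_zero_right)
  with assms have "weight w (a + single i 1) \<le> \<gamma>"
    by (auto simp: deg_le_def)
  then show "weight w a \<le> \<gamma> - w i"
    by (simp add: weight_add le_diff_eq)
qed

lemma component_pderiv_var:
  "component w (\<gamma> - w i) (pderiv_var i p) = pderiv_var i (component w \<gamma> p)"
  for w :: "'n::finite \<Rightarrow> 'g::linordered_ab_group_add"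
  by (rule poly_mapping_eqI)
    (auto simp: lookup_component lookup_pderiv_var weight_add eq_diff_eq)

lemma monomial_value_UNIV: "monomial_value g a = (\<Prod>v\<in>UNIV. g v ^ lookup a v)"
  for g :: "'v::finite \<Rightarrow> _"
  by (rule monomial_value_superset) auto

lemma component_monomial_value:
  fixes g :: "'m::finite \<Rightarrow> ('n::finite, 'k::comm_ring_1) mpoly"
  assumes g: "\<And>i. deg_le w (d i) (g i)"
  shows "deg_le w (weight d a) (monomial_value g a) \<and>
    component w (weight d a) (monomial_value g a) = monomial_value (\<lambda>i. component w (d i) (g i)) a"
proof -
  have 1: "deg_le w 0 (1 :: ('n, 'k) mpoly) \<and> component w 0 (1 :: ('n, 'k) mpoly) = 1"
    using deg_le_const[of 0 w "1::'k"] component_single[of w 0 0 "1::'k"] by simp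
  have pow: "deg_le w (\<Sum>_<n. d i) (g i ^ n) \<and>
      component w (\<Sum>_<n. d i) (g i ^ n) = component w (d i) (g i) ^ n" for i n
  proof (induction n)
    case (Suc n)
    with deg_le_mult[of w _ "g i ^ n" _ "g i"] component_mult[of w _ "g i ^ n" _ "g i"] g
    show ?case by (simp add: power_Suc2 del: power_Suc)
  qed (use 1 in simp)
  have "deg_le w (\<Sum>i\<in>A. \<Sum>_<lookup a i. d i) (\<Prod>i\<in>A. g i ^ lookup a i) \<and>
      component w (\<Sum>i\<in>A. \<Sum>_<lookup a i. d i) (\<Prod>i\<in>A. g i ^ lookup a i) =
      (\<Prod>i\<in>A. component w (d i) (g i) ^ lookup a i)" for A
    by (induction A rule: infinite_finite_induct)
      (use pow 1 in \<open>simp_all add: deg_le_mult component_mult\<close>)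
  then show ?thesis
    by (simp add: weight_def monomial_value_UNIV)
qed

text \<open>
  Substituting \<open>g\<close> into \<open>p\<close> commutes with passing to leading forms when the variables of \<open>p\<close> are
  weighted by the degrees of the \<open>g i\<close>, except that the result may be zero.
\<close>

lemma component_eval:
  fixes g :: "'m::finite \<Rightarrow> ('n::finite, 'k::comm_ring_1) mpoly"
  assumes g: "\<And>i. deg_le w (d i) (g i)" and p: "deg_le d \<gamma> p"
  shows "deg_le w \<gamma> (eval_mpoly const g p)"
    and "component w \<gamma> (eval_mpoly const g p) =
      eval_mpoly const (\<lambda>i. component w (d i) (g i)) (component d \<gamma> p)"
proof -
  have eval: "eval_mpoly const h p = (\<Sum>a\<in>keys p. const (lookup p a) * monomial_value h a)"
    for h :: "'m \<Rightarrow> ('n, 'k) mpoly"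
    by (simp add: eval_mpoly_alt)
  have deg: "deg_le w (weight d a) (const (lookup p a) * monomial_value g a)" for a
    using deg_le_mult[OF deg_le_const[OF order_refl], of w "weight d a" "monomial_value g a" "lookup p a"]
      component_monomial_value[of w d g a, OF g] by simp
  show "deg_le w \<gamma> (eval_mpoly const g p)"
    unfolding eval using deg p by (intro deg_le_sum) (auto simp: deg_le_def[of d] intro: deg_le_mono)
  have "component w \<gamma> (eval_mpoly const g p) =
      (\<Sum>a\<in>keys p. component w \<gamma> (const (lookup p a) * monomial_value g a))"
    by (simp add: eval component_sum)
  also have "\<dots> = (\<Sum>a\<in>keys p. eval_mpoly const (\<lambda>i. component w (d i) (g i))
      (component d \<gamma> (single a (lookup p a))))"
  proof (intro sum.cong refl)
    fix a assume "a \<in> keys p"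
    then have le: "weight d a \<le> \<gamma>"
      using p by (simp add: deg_le_def)
    show "component w \<gamma> (const (lookup p a) * monomial_value g a) =
        eval_mpoly const (\<lambda>i. component w (d i) (g i)) (component d \<gamma> (single a (lookup p a)))"
    proof (cases "weight d a = \<gamma>")
      case True
      have "component w (0 + \<gamma>) (const (lookup p a) * monomial_value g a) =
          component w 0 (const (lookup p a)) * component w \<gamma> (monomial_value g a)"
        using component_monomial_value[of w d g a, OF g] True
        by (intro component_mult) (simp_all add: deg_le_const)
      with True component_monomial_value[of w d g a, OF g] show ?thesis
        by (simp add: component_single const.eval_single) (simp add: const_def component_single)
    next
      case False
      with le show ?thesis
        using component_eq_0[OF deg, of a \<gamma>] by (simp add: component_single)
    qed
  qed
  also have "\<dots> = eval_mpoly const (\<lambda>i. component w (d i) (g i)) (component d \<gamma> p)"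
    by (simp only: const.eval_sum[symmetric] component_sum[symmetric] sum_of_monomials)
  finally show "component w \<gamma> (eval_mpoly const g p) =
      eval_mpoly const (\<lambda>i. component w (d i) (g i)) (component d \<gamma> p)" .
qed

abbreviation total_degree :: "('n::finite, 'k::zero) mpoly \<Rightarrow> int"
  where "total_degree \<equiv> wdeg (\<lambda>_. 1)"

lemma weight_1: "weight (\<lambda>_. 1 :: int) a = int (\<Sum>i\<in>UNIV. lookup a i)"
  by (simp add: weight_def)

lemma total_degree_le_0:
  assumes "p \<noteq> 0" "total_degree p \<le> 0"
  obtains c where "p = const c" "c \<noteq> 0"
proof -
  have "a = 0" if "a \<in> keys p" for a
  proof -
    have "weight (\<lambda>_. 1 :: int) a \<le> 0"
      using assms that by (simp add: wdeg_le_iff deg_le_def)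
    then have "(\<Sum>i\<in>UNIV. lookup a i) = 0"
      unfolding weight_1 by linarith
    then show "a = 0"
      by (auto intro!: poly_mapping_eqI)
  qed
  then have "p = const (lookup p 0)"
    by (intro const_if_keys) blast
  with assms that show ?thesis
    by (metis const_eq_0_iff)
qed

lemma total_degree_nonneg: "p \<noteq> 0 \<Longrightarrow> 0 \<le> total_degree p"
  by (simp add: wdeg_nonneg)

lemma const_unit: "c \<noteq> 0 \<Longrightarrow> const c dvd 1" for c :: "'k::field"
  by (metis const_1 const_mult dvd_triv_left right_inverse)

lemma unit_iff_total_degree:
  fixes p :: "('n::{finite,linorder}, 'k::field) mpoly"
  assumes "p \<noteq> 0"
  shows "p dvd 1 \<longleftrightarrow> total_degree p = 0"
proof
  assume "total_degree p = 0"
  then show "p dvd 1"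
    using total_degree_le_0[OF assms] const_unit by (metis order_refl)
qed (simp add: wdeg_unit)

lemma total_degree_nonunit:
  fixes p :: "('n::{finite,linorder}, 'k::field) mpoly"
  shows "p \<noteq> 0 \<Longrightarrow> \<not> p dvd 1 \<Longrightarrow> 0 < total_degree p"
  using total_degree_nonneg[of p] by (simp add: unit_iff_total_degree order_less_le)

section \<open>Existence of prime factors\<close>

abbreviation var_weight :: "'n \<Rightarrow> 'n \<Rightarrow> int"
  where "var_weight v \<equiv> (\<lambda>j. if j = v then 1 else 0)"

definition degree_in :: "'n::finite \<Rightarrow> ('n, 'k::zero) mpoly \<Rightarrow> nat"
  where "degree_in v p = nat (wdeg (var_weight v) p)"

lemma weight_var_weight: "weight (var_weight v) a = int (lookup a v)"
proof -
  have "weight (var_weight v) a = (\<Sum>i\<in>UNIV. if i = v then int (lookup a i) else 0)"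
    unfolding weight_def by (rule sum.cong) auto
  then show ?thesis by simp
qed

lemma polys_in_iff: "p \<in> polys_in S \<longleftrightarrow> (\<forall>v. v \<notin> S \<longrightarrow> deg_le (var_weight v) 0 p)"
  for p :: "('n::finite, 'k::zero) mpoly"
  by (auto simp: polys_in_def deg_le_def weight_var_weight subset_iff not_in_keys_iff_lookup_eq_zero[symmetric])

lemma polys_in_factor:
  fixes p q :: "('n::{finite,linorder}, 'k::field) mpoly"
  assumes "p * q \<in> polys_in S" "p * q \<noteq> 0"
  shows "p \<in> polys_in S"
  unfolding polys_in_iff
proof (intro allI impI)
  fix v assume "v \<notin> S"
  let ?w = "var_weight v"
  have nz: "p \<noteq> 0" "q \<noteq> 0"
    using assms(2) by auto
  have "wdeg ?w p + wdeg ?w q \<le> 0"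
    using assms \<open>v \<notin> S\<close> by (simp add: polys_in_iff wdeg_le_iff flip: wdeg_mult[OF nz])
  moreover have "0 \<le> wdeg ?w q"
    using nz by (simp add: wdeg_nonneg)
  ultimately show "deg_le ?w 0 p"
    using nz by (simp flip: wdeg_le_iff)
qed

lemma polys_in_quotient:
  fixes p q :: "('n::{finite,linorder}, 'k::field) mpoly"
  assumes "p * q \<in> polys_in S" "p \<noteq> 0"
  shows "q \<in> polys_in S"
  using assms polys_in_factor[of q p S] by (cases "q = 0") (simp_all add: mult.commute)

lemma degree_in_mult:
  fixes p q :: "('n::{finite,linorder}, 'k::field) mpoly"
  shows "p \<noteq> 0 \<Longrightarrow> q \<noteq> 0 \<Longrightarrow> degree_in v (p * q) = degree_in v p + degree_in v q"
  by (simp add: degree_in_def wdeg_mult nat_add_distrib wdeg_nonneg)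

lemma wdeg_var_weight: "p \<noteq> 0 \<Longrightarrow> wdeg (var_weight v) p = int (degree_in v p)"
  by (simp add: degree_in_def wdeg_nonneg)

lemma degree_in_eq_0_iff:
  assumes "p \<in> polys_in S" "p \<noteq> 0"
  shows "degree_in v p = 0 \<longleftrightarrow> p \<in> polys_in (S - {v})"
  using assms by (auto simp: degree_in_def polys_in_iff wdeg_le_iff)

text \<open>
  The remainders of pseudo-division by a polynomial of degree \<open>n\<close> in \<open>v\<close>. Zero belongs here, which
  the value \<open>degree_in v 0\<close> would not express.
\<close>

definition low_degree :: "'v \<Rightarrow> nat \<Rightarrow> ('v, 'k::zero) mpoly set"
  where "low_degree v n = {p. \<forall>a\<in>keys p. lookup a v < n}"

lemma low_degree_iff: "p \<in> low_degree v n \<longleftrightarrow> p = 0 \<or> degree_in v p < n"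
proof (cases "p = 0")
  case False
  then have "degree_in v p < n \<longleftrightarrow> wdeg (var_weight v) p < int n"
    by (simp add: wdeg_var_weight)
  also have "\<dots> \<longleftrightarrow> p \<in> low_degree v n"
    using False by (simp add: wdeg_eq_Max low_degree_def weight_var_weight)
  finally show ?thesis using False by simp
qed (simp add: low_degree_def)

lemma low_degree_diff: "p \<in> low_degree v n \<Longrightarrow> q \<in> low_degree v n \<Longrightarrow> p - q \<in> low_degree v n"
  for p q :: "('v, 'k::comm_ring_1) mpoly"
  using keys_diff[of p q] by (auto simp: low_degree_def)

lemma low_degree_mult:
  fixes p q :: "('n::{finite,linorder}, 'k::field) mpoly"
  assumes "q \<in> low_degree v n" "degree_in v p + n \<le> m"
  shows "p * q \<in> low_degree v m"
  using assms by (cases "p = 0"; cases "q = 0") (auto simp: low_degree_iff degree_in_mult)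

lemma lead_form_mult:
  fixes p q :: "('n::{finite,linorder}, 'k::idom) mpoly"
  shows "p \<noteq> 0 \<Longrightarrow> q \<noteq> 0 \<Longrightarrow> lead_form w (p * q) = lead_form w p * lead_form w q"
  by (simp add: lead_form_def wdeg_mult component_mult deg_le_wdeg)

text \<open>
  For the weight that sees only \<open>v\<close>, the leading form is the leading term of \<open>p\<close> as a polynomial in
  \<open>v\<close>. In this way the general theory of weighted degrees also provides the one-variable view of
  polynomials that pseudo-division and Gauss's lemma work with.
\<close>

lemma lead_form_var_weight:
  fixes p :: "('n::{finite,linorder}, 'k::field) mpoly"
  assumes "p \<in> polys_in S" "p \<noteq> 0"
  obtains c where "c \<in> polys_in (S - {v})" "c \<noteq> 0"
    "lead_form (var_weight v) p = c * Var v ^ degree_in v p"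
proof -
  let ?l = "lead_form (var_weight v) p" and ?n = "degree_in v p"
  define c where "c = (\<Sum>a\<in>keys ?l. single (a - single v ?n) (lookup ?l a))"
  have a: "lookup a v = ?n \<and> keys a \<subseteq> S" if "a \<in> keys ?l" for a
  proof -
    have "lookup ?l a \<noteq> 0"
      using that by (simp add: in_keys_iff)
    then have "weight (var_weight v) a = int ?n" "lookup p a \<noteq> 0"
      using assms(2) by (auto simp: lead_form_def lookup_component wdeg_var_weight split: if_splits)
    then show ?thesis
      using assms(1) by (auto simp: weight_var_weight polys_in_def in_keys_iff)
  qed
  have "c * Var v ^ ?n = (\<Sum>a\<in>keys ?l. single (a - single v ?n + single v ?n) (lookup ?l a))"
    by (simp add: c_def Var_power sum_distrib_right mult_single)
  also have "\<dots> = (\<Sum>a\<in>keys ?l. single a (lookup ?l a))"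
  proof (intro sum.cong refl arg_cong2[where f=single] poly_mapping_eqI)
    fix a j assume "a \<in> keys ?l"
    with a show "lookup (a - single v ?n + single v ?n) j = lookup a j"
      by (cases "j = v") (auto simp: lookup_add lookup_minus lookup_single)
  qed
  finally have eq: "?l = c * Var v ^ ?n"
    by (simp only: sum_of_monomials)
  have "keys c \<subseteq> (\<Union>a\<in>keys ?l. {a - single v ?n})"
    unfolding c_def by (rule order_trans[OF keys_sum]) auto
  moreover have "keys (a - single v ?n) \<subseteq> S - {v}" if "a \<in> keys ?l" for a
    using a[OF that] by (force simp: in_keys_iff lookup_minus lookup_single when_def)
  ultimately have "c \<in> polys_in (S - {v})"
    by (auto simp: polys_in_def)
  moreover have "c \<noteq> 0"
    using eq lead_form_nonzero[OF assms(2), of "var_weight v"] by auto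
  ultimately show ?thesis using eq that by blast
qed

lemma remove_lead_form:
  fixes p :: "('n::{finite,linorder}, 'k::field) mpoly"
  assumes "p \<in> polys_in S"
  shows "p - lead_form (var_weight v) p \<in> polys_in S"
    and "p - lead_form (var_weight v) p \<in> low_degree v (degree_in v p)"
proof -
  let ?r = "p - lead_form (var_weight v) p"
  show "?r \<in> polys_in S"
    using assms by (simp add: lead_form_def polys_in_diff polys_in_component)
  show "?r \<in> low_degree v (degree_in v p)"
    unfolding low_degree_def
  proof clarify
    fix a assume "a \<in> keys ?r"
    then have a: "lookup p a \<noteq> 0" "weight (var_weight v) a \<noteq> wdeg (var_weight v) p"
      by (auto simp: in_keys_iff lookup_minus lead_form_def lookup_component split: if_splits)
    then have "weight (var_weight v) a \<le> wdeg (var_weight v) p" and "p \<noteq> 0"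
      using deg_le_wdeg[of "var_weight v" p] by (auto simp: deg_le_def in_keys_iff)
    with a show "lookup a v < degree_in v p"
      by (simp add: weight_var_weight wdeg_var_weight)
  qed
qed

lemma degree_in_lead_coeff:
  "c \<in> polys_in (S - {v}) \<Longrightarrow> c \<noteq> 0 \<Longrightarrow> degree_in v c = 0"
  using polys_in_mono[of "S - {v}" S] degree_in_eq_0_iff by blast

lemma degree_in_Var_power:
  "degree_in v (Var v ^ n :: ('n::{finite,linorder}, 'k::field) mpoly) = n"
proof -
  have "wdeg (var_weight v) (Var v ^ n :: ('n, 'k) mpoly) = int n"
    by (rule wdeg_eqI)
      (simp_all add: Var_power deg_le_def component_nonzero_iff weight_var_weight)
  then show ?thesis by (simp add: degree_in_def)
qed

text \<open>
  Each step cancels the leading terms of \<open>f\<close> and \<open>g\<close> after multiplying \<open>f\<close> by the leading coefficient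
  of \<open>g\<close>; the factor \<open>c\<close> is the product of these multipliers.
\<close>

lemma pseudo_division:
  fixes f g :: "('n::{finite,linorder}, 'k::field) mpoly"
  assumes v: "v \<in> S" and f: "f \<in> polys_in S" and g: "g \<in> polys_in S" "g \<noteq> 0"
  shows "\<exists>c\<in>polys_in (S - {v}). c \<noteq> 0 \<and> (\<exists>s\<in>polys_in S. \<exists>r\<in>polys_in S.
    c * f = g * s + r \<and> r \<in> low_degree v (degree_in v g))"
  using f
proof (induction "degree_in v f" arbitrary: f rule: less_induct)
  case less
  note f = \<open>f \<in> polys_in S\<close>
  let ?n = "degree_in v f" and ?m = "degree_in v g"
  have A: "c \<in> polys_in S" if "c \<in> polys_in (S - {v})" for c :: "('n, 'k) mpoly"
    using that polys_in_mono[of "S - {v}" S] by blast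
  show ?case
  proof (cases "f = 0 \<or> ?n < ?m")
    case True
    then have "1 * f = g * 0 + f \<and> f \<in> low_degree v ?m"
      by (simp add: low_degree_iff)
    then show ?thesis
      using f by (metis polys_in_0 polys_in_1 zero_neq_one)
  next
    case False
    then have nz: "f \<noteq> 0" and le: "?m \<le> ?n" by auto
    obtain c where c: "c \<in> polys_in (S - {v})" "c \<noteq> 0"
      and lf: "lead_form (var_weight v) f = c * Var v ^ ?n"
      using lead_form_var_weight[OF f nz] by blast
    obtain d where d: "d \<in> polys_in (S - {v})" "d \<noteq> 0"
      and lg: "lead_form (var_weight v) g = d * Var v ^ ?m"
      using lead_form_var_weight[OF g] by blast
    define f' where "f' = f - lead_form (var_weight v) f"
    define g' where "g' = g - lead_form (var_weight v) g"
    let ?x = "Var v ^ (?n - ?m) :: ('n, 'k) mpoly"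
    define h where "h = d * f - g * (c * ?x)"
    have "h = d * f' - (c * ?x) * g'"
      using le by (simp add: h_def f'_def g'_def lf lg algebra_simps flip: power_add)
    moreover have "d * f' \<in> low_degree v ?n"
      using remove_lead_form(2)[OF f] degree_in_lead_coeff[OF d]
      by (intro low_degree_mult) (auto simp: f'_def)
    moreover have "(c * ?x) * g' \<in> low_degree v ?n"
    proof (rule low_degree_mult)
      show "g' \<in> low_degree v ?m"
        using remove_lead_form(2)[OF g(1)] by (simp add: g'_def)
      have "?x \<noteq> 0" by (simp add: Var_power flip: keys_eq_empty)
      then show "degree_in v (c * ?x) + ?m \<le> ?n"
        using c le by (simp add: degree_in_mult degree_in_lead_coeff[OF c] degree_in_Var_power)
    qed
    ultimately have "h \<in> low_degree v ?n"
      by (simp add: low_degree_diff)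
    then have h: "h = 0 \<or> degree_in v h < ?n"
      by (simp add: low_degree_iff)
    have cx: "c * ?x \<in> polys_in S"
      using A c v by (intro polys_in_mult polys_in_power polys_in_Var) auto
    have hS: "h \<in> polys_in S"
      unfolding h_def using A[OF d(1)] f g(1) cx 
        by (intro polys_in_diff polys_in_mult[OF A[OF d(1)] f] polys_in_mult[OF g(1) cx])
    have "\<exists>e\<in>polys_in (S - {v}). e \<noteq> 0 \<and> (\<exists>s\<in>polys_in S. \<exists>r\<in>polys_in S.
        e * h = g * s + r \<and> r \<in> low_degree v ?m)"
    proof (cases "h = 0")
      case True
      then have "1 * h = g * 0 + 0 \<and> (0 :: ('n, 'k) mpoly) \<in> low_degree v ?m"
        by (simp add: low_degree_iff)
      then show ?thesis by (metis polys_in_0 polys_in_1 zero_neq_one)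
    qed (use h hS less.hyps in blast)
    then obtain e s r where e: "e \<in> polys_in (S - {v})" "e \<noteq> 0" and s: "s \<in> polys_in S"
      and r: "r \<in> polys_in S" "r \<in> low_degree v ?m" and eq: "e * h = g * s + r"
      by blast
    have "e * d * f = e * h + g * (e * (c * ?x))"
      by (simp add: h_def algebra_simps)
    also have "\<dots> = g * (s + e * (c * ?x)) + r"
      by (simp add: eq algebra_simps)
    finally have "e * d * f = g * (s + e * (c * ?x)) + r" .
    moreover have "s + e * (c * ?x) \<in> polys_in S" "e * d \<in> polys_in (S - {v})" "e * d \<noteq> 0"
      using e d s cx A by (auto intro!: polys_in_add polys_in_mult)
    ultimately show ?thesis using r by blast
  qed
qed

text \<open>
  Primality is relative to a subring because existence of prime factors is proved by induction on the
  set of available variables. Divisibility need not be relativised: by \<open>polys_in_quotient\<close>, a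
  quotient of polynomials in the variables \<open>S\<close> involves only \<open>S\<close>.
\<close>

definition prime_in :: "'v set \<Rightarrow> ('v, 'k::comm_ring_1) mpoly \<Rightarrow> bool"
  where "prime_in S q \<longleftrightarrow> q \<in> polys_in S \<and> q \<noteq> 0 \<and> \<not> q dvd 1 \<and>
    (\<forall>a\<in>polys_in S. \<forall>b\<in>polys_in S. q dvd a * b \<longrightarrow> q dvd a \<or> q dvd b)"

text \<open>
  The first argument fixes the coefficient field, which the set of variables does not determine.
\<close>

definition has_prime_factors :: "'k::field itself \<Rightarrow> 'v set \<Rightarrow> bool"
  where "has_prime_factors _ S \<longleftrightarrow> (\<forall>p :: ('v, 'k) mpoly. p \<in> polys_in S \<longrightarrow> p \<noteq> 0 \<longrightarrow>
    \<not> p dvd 1 \<longrightarrow> (\<exists>q. prime_in S q \<and> q dvd p))"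

text \<open>
  Gauss's lemma. If \<open>q\<close> divides \<open>a * b\<close>, it divides the product of the leading coefficients, so it
  divides the leading term of \<open>a\<close> or of \<open>b\<close>; removing that term keeps the hypothesis and lowers a
  degree.
\<close>

lemma prime_in_extend:
  fixes q :: "('n::{finite,linorder}, 'k::field) mpoly"
  assumes q: "prime_in (S - {v}) q"
  shows "prime_in S q"
proof -
  have qA: "q \<in> polys_in (S - {v})" "q \<noteq> 0"
    using q by (auto simp: prime_in_def)
  have lq: "lead_form (var_weight v) q = q"
  proof -
    have d: "wdeg (var_weight v) q = 0"
      using qA degree_in_lead_coeff[OF qA] by (simp add: wdeg_var_weight)
    have "weight (var_weight v) a = 0" if "a \<in> keys q" for a
    proof -
      have "v \<notin> keys a" using qA that by (auto simp: polys_in_def)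
      then show ?thesis by (simp add: weight_var_weight in_keys_iff)
    qed
    then show ?thesis
      unfolding lead_form_def d by (intro poly_mapping_eqI) (auto simp: lookup_component in_keys_iff)
  qed
  have "q dvd a \<or> q dvd b" if "a \<in> polys_in S" "b \<in> polys_in S" "q dvd a * b" for a b
    using that
  proof (induction "degree_in v a + degree_in v b" arbitrary: a b rule: less_induct)
    case less
    note a = less.prems(1) and b = less.prems(2) and q_dvd = less.prems(3)
    show ?case
    proof (cases "a = 0 \<or> b = 0")
      case False
      then have nz: "a \<noteq> 0" "b \<noteq> 0" by auto
      obtain e where e: "a * b = q * e"
        using q_dvd by blast
      have "e \<noteq> 0" using e nz by auto
      have eS: "e \<in> polys_in S"
        using polys_in_quotient[of q e S] e qA polys_in_mult[OF a b] by simp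
      obtain c where c: "c \<in> polys_in (S - {v})" "c \<noteq> 0"
        and la: "lead_form (var_weight v) a = c * Var v ^ degree_in v a"
        using lead_form_var_weight[OF a nz(1)] by blast
      obtain d where d: "d \<in> polys_in (S - {v})" "d \<noteq> 0"
        and lb: "lead_form (var_weight v) b = d * Var v ^ degree_in v b"
        using lead_form_var_weight[OF b nz(2)] by blast
      obtain k where k: "lead_form (var_weight v) e = k * Var v ^ degree_in v e"
        using lead_form_var_weight[OF eS \<open>e \<noteq> 0\<close>] by blast
      have deg: "degree_in v e = degree_in v a + degree_in v b"
        using arg_cong[OF e, of "degree_in v"] nz \<open>e \<noteq> 0\<close> qA
        by (simp add: degree_in_mult degree_in_lead_coeff)
      have "q * k * Var v ^ degree_in v e = c * d * Var v ^ degree_in v e"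
        using arg_cong[OF e, of "lead_form (var_weight v)"]
        unfolding lead_form_mult[OF nz] lead_form_mult[OF qA(2) \<open>e \<noteq> 0\<close>] la lb k lq deg power_add
        by (simp only: mult.assoc mult.commute mult.left_commute)
      moreover have "Var v ^ degree_in v e \<noteq> (0 :: ('n, 'k) mpoly)"
        by (simp add: Var_power flip: keys_eq_empty)
      ultimately have "q dvd c * d"
        by (metis dvd_triv_left mult_right_cancel)
      then consider "q dvd c" | "q dvd d"
        using q c d by (auto simp: prime_in_def)
      then show ?thesis
      proof cases
        case 1
        let ?a = "a - lead_form (var_weight v) a"
        have l: "q dvd lead_form (var_weight v) a"
          using 1 by (simp add: la)
        then have "q dvd ?a * b"
          using q_dvd by (simp add: left_diff_distrib dvd_diff)
        moreover have "?a = 0 \<or> degree_in v ?a < degree_in v a"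
          using remove_lead_form(2)[OF a] by (simp add: low_degree_iff)
        ultimately have "q dvd ?a \<or> q dvd b"
          using less.hyps[of ?a b] remove_lead_form(1)[OF a] b by (cases "?a = 0") auto
        then show ?thesis
          using l by (metis dvd_add_right_iff diff_add_cancel add.commute)
      next
        case 2
        let ?b = "b - lead_form (var_weight v) b"
        have l: "q dvd lead_form (var_weight v) b"
          using 2 by (simp add: lb)
        then have "q dvd a * ?b"
          using q_dvd by (simp add: right_diff_distrib dvd_diff)
        moreover have "?b = 0 \<or> degree_in v ?b < degree_in v b"
          using remove_lead_form(2)[OF b] by (simp add: low_degree_iff)
        ultimately have "q dvd a \<or> q dvd ?b"
          using less.hyps[of a ?b] remove_lead_form(1)[OF b] a by (cases "?b = 0") auto
        then show ?thesis
          using l by (metis dvd_add_right_iff diff_add_cancel add.commute)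
      qed
    qed auto
  qed
  then show ?thesis
    using q polys_in_mono[of "S - {v}" S] by (auto simp: prime_in_def)
qed

text \<open>
  A factor \<open>c\<close> free of \<open>v\<close> of a product \<open>h * s\<close> can be distributed over \<open>h\<close> and \<open>s\<close>: each prime factor of
  \<open>c\<close> remains prime when \<open>v\<close> is added, hence divides one of them. This is what replaces passing to the
  field of fractions of the coefficients.
\<close>

lemma split_content:
  fixes c p h s :: "('n::{finite,linorder}, 'k::field) mpoly"
  assumes A: "has_prime_factors TYPE('k) (S - {v})"
    and c: "c \<in> polys_in (S - {v})" "c \<noteq> 0"
    and hs: "h \<in> polys_in S" "s \<in> polys_in S" and eq: "c * p = h * s"
  shows "\<exists>c1\<in>polys_in (S - {v}). \<exists>c2\<in>polys_in (S - {v}). \<exists>h' s'.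
    h = c1 * h' \<and> s = c2 * s' \<and> p = h' * s'"
  using c hs eq
proof (induction "nat (total_degree c)" arbitrary: c h s rule: less_induct)
  case less
  note c = less.prems(1,2) and hs = less.prems(3,4) and eq = less.prems(5)
  show ?case
  proof (cases "c dvd 1")
    case True
    then obtain e where e: "1 = c * e" by blast
    have "h = c * (e * h)"
      using arg_cong[OF e, of "\<lambda>x. x * h"] by (simp add: mult.assoc)
    moreover have "p = (e * h) * s"
      using e eq by (metis mult.assoc mult.commute mult_1)
    ultimately show ?thesis
      using c by (metis mult_1 polys_in_1)
  next
    case False
    then obtain q where q: "prime_in (S - {v}) q" "q dvd c"
      using A c by (auto simp: has_prime_factors_def)
    then obtain c0 where c0: "c = q * c0" by blast
    have nz: "q \<noteq> 0" "c0 \<noteq> 0" using c c0 by auto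
    have "\<not> q dvd 1" using q by (simp add: prime_in_def)
    then have "nat (total_degree c0) < nat (total_degree c)"
      using total_degree_nonunit[of q] total_degree_nonneg[of c0] nz by (simp add: c0 wdeg_mult)
    moreover have c0A: "c0 \<in> polys_in (S - {v})"
      using polys_in_quotient[of q c0] c c0 nz by simp
    moreover note nz(2)
    ultimately have IH: "\<exists>c1\<in>polys_in (S - {v}). \<exists>c2\<in>polys_in (S - {v}). \<exists>h' s'.
        h = c1 * h' \<and> s = c2 * s' \<and> p = h' * s'"
      if "h \<in> polys_in S" "s \<in> polys_in S" "c0 * p = h * s" for h s
      using less.hyps that by blast
    have qA: "q \<in> polys_in (S - {v})" using q by (simp add: prime_in_def)
    have "q dvd h * s"
      using c0 eq by (metis dvd_triv_left mult.assoc)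
    then consider "q dvd h" | "q dvd s"
      using prime_in_extend[OF q(1)] hs by (auto simp: prime_in_def)
    then show ?thesis
    proof cases
      case 1
      then obtain h0 where h0: "h = q * h0" by blast
      have "c0 * p = h0 * s"
        using eq nz by (simp add: c0 h0 mult.assoc)
      moreover have "h0 \<in> polys_in S"
        using polys_in_quotient[of q h0] hs h0 nz by simp
      ultimately obtain c1 c2 h' s' where c1: "c1 \<in> polys_in (S - {v})"
        and "c2 \<in> polys_in (S - {v})" "h0 = c1 * h'" "s = c2 * s'" "p = h' * s'"
        using IH[of h0 s] hs(2) by blast
      moreover have "q * c1 \<in> polys_in (S - {v})"
        using qA c1 by (rule polys_in_mult)
      moreover have "h = q * c1 * h'"
        by (simp add: h0 \<open>h0 = c1 * h'\<close> mult.assoc)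
      ultimately show ?thesis by blast
    next
      case 2
      then obtain s0 where s0: "s = q * s0" by blast
      have "c0 * p = h * s0"
        using eq nz by (simp add: c0 s0 ac_simps)
      moreover have "s0 \<in> polys_in S"
        using polys_in_quotient[of q s0] hs s0 nz by simp
      ultimately obtain c1 c2 h' s' where c2: "c2 \<in> polys_in (S - {v})"
        and "c1 \<in> polys_in (S - {v})" "h = c1 * h'" "s0 = c2 * s'" "p = h' * s'"
        using IH[of h s0] hs(1) by blast
      moreover have "q * c2 \<in> polys_in (S - {v})"
        using qA c2 by (rule polys_in_mult)
      moreover have "s = q * c2 * s'"
        by (simp add: s0 \<open>s0 = c2 * s'\<close> mult.assoc)
      ultimately show ?thesis by blast
    qed
  qed
qed

text \<open>
  Induction on the total degree reduces to an irreducible \<open>p\<close> that has no prime factor free of \<open>v\<close>,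
  and such a \<open>p\<close> is itself prime. Suppose \<open>p\<close> divides \<open>a * b\<close> but not \<open>a\<close>, and let \<open>h\<close> be a nonzero element
  of least degree in \<open>v\<close> of the ideal generated by \<open>p\<close> and \<open>a\<close>. By pseudo-division \<open>h\<close> divides multiples of
  \<open>p\<close> and of \<open>a\<close> by factors free of \<open>v\<close>. Up to such factors and units, irreducibility leaves two
  cases: \<open>h\<close> is \<open>p\<close>, and then \<open>p\<close> would divide \<open>a\<close>; or \<open>h\<close> is free of \<open>v\<close>, and then \<open>p\<close> divides \<open>h * b\<close> and
  so \<open>b\<close>.
\<close>

lemma has_prime_factors_extend:
  fixes v :: "'n::{finite,linorder}"
  assumes A: "has_prime_factors TYPE('k::field) (S - {v})" and v: "v \<in> S"
  shows "has_prime_factors TYPE('k) S"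
proof -
  have SA: "polys_in (S - {v}) \<subseteq> (polys_in S :: ('n, 'k) mpoly set)"
    by (rule polys_in_mono) auto
  have "\<exists>q. prime_in S q \<and> q dvd p"
    if "p \<in> polys_in S" "p \<noteq> 0" "\<not> p dvd 1" for p :: "('n, 'k) mpoly"
    using that
  proof (induction "nat (total_degree p)" arbitrary: p rule: less_induct)
    case less
    note p = less.prems
    show ?case
    proof (cases "\<exists>q. prime_in (S - {v}) q \<and> q dvd p")
      case True
      then show ?thesis using prime_in_extend by blast
    next
      case False
      then have primitive: "\<not> q dvd p" if "prime_in (S - {v}) q" for q
        using that by blast
      \<comment> \<open>no prime factor of \<open>c\<close> can be absorbed by \<open>p\<close>\<close>
      have cancel: "p dvd b"
        if c: "c \<in> polys_in (S - {v})" "c \<noteq> 0" and b: "b \<in> polys_in S" and "p dvd c * b" for b c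
      proof (cases "b = 0")
        case False
        obtain t where t: "c * b = p * t" using \<open>p dvd c * b\<close> by blast
        have "t \<in> polys_in S"
          using polys_in_factor[of t p S] c b SA False t
          by (metis mult.commute no_zero_divisors polys_in_mult subsetD)
        then obtain c1 c2 p' t' where c1: "c1 \<in> polys_in (S - {v})"
          and eqs: "p = c1 * p'" "t = c2 * t'" "b = p' * t'"
          using split_content[OF A c p(1) _ t] by blast
        have "c1 dvd 1"
        proof (rule ccontr)
          assume "\<not> c1 dvd 1"
          then obtain q where "prime_in (S - {v}) q" "q dvd c1"
            using A c1 p(2) eqs(1) unfolding has_prime_factors_def by fastforce
          then show False using primitive eqs(1) by (metis dvd_mult2)
        qed
        then have "p dvd p'"
          by (simp add: eqs(1))
        then show ?thesis by (simp add: eqs(3))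
      qed auto
      show ?thesis
      proof (cases "\<exists>a b. p = a * b \<and> \<not> a dvd 1 \<and> \<not> b dvd 1")
        case True
        then obtain a b where ab: "p = a * b" "\<not> a dvd 1" "\<not> b dvd 1" by blast
        then have nz: "a \<noteq> 0" "b \<noteq> 0" using p by auto
        have "nat (total_degree a) < nat (total_degree p)"
          using total_degree_nonunit[of b] total_degree_nonneg[of a] nz ab
          by (simp add: wdeg_mult)
        moreover have "a \<in> polys_in S"
          using polys_in_factor p ab by blast
        ultimately show ?thesis
          using less.hyps[of a] nz ab by (auto intro: dvd_mult2)
      next
        case False
        then have irr: "a dvd 1 \<or> b dvd 1" if "p = a * b" for a b
          using that by blast
        have "p dvd b" if a: "a \<in> polys_in S" and b: "b \<in> polys_in S" and "p dvd a * b"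
          and "\<not> p dvd a" for a b
        proof -
          define I where "I = {x * p + y * a | x y. x \<in> polys_in S \<and> y \<in> polys_in S}"
          have pI: "p \<in> I"
            unfolding I_def by (rule CollectI, rule exI[of _ 1], rule exI[of _ 0]) simp
          have aI: "a \<in> I"
            unfolding I_def by (rule CollectI, rule exI[of _ 0], rule exI[of _ 1]) simp
          have I_S: "f \<in> polys_in S" if "f \<in> I" for f
            using that a p by (auto simp: I_def intro!: polys_in_add polys_in_mult)
          have I_diff: "c * f - s * g \<in> I"
            if "f \<in> I" "g \<in> I" "c \<in> polys_in S" "s \<in> polys_in S" for c f s g
          proof -
            obtain x y x' y' where "f = x * p + y * a" "g = x' * p + y' * a"
              "x \<in> polys_in S" "y \<in> polys_in S" "x' \<in> polys_in S" "y' \<in> polys_in S"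
              using \<open>f \<in> I\<close> \<open>g \<in> I\<close> by (auto simp: I_def)
            moreover from this have "c * f - s * g = (c * x - s * x') * p + (c * y - s * y') * a"
              by (simp add: algebra_simps)
            ultimately show ?thesis
              using that unfolding I_def by (blast intro: polys_in_diff polys_in_mult)
          qed
          obtain h where h: "h \<in> I" "h \<noteq> 0"
            and h_min: "\<And>g. g \<in> I \<Longrightarrow> g \<noteq> 0 \<Longrightarrow> degree_in v h \<le> degree_in v g"
            using ex_has_least_nat[of "\<lambda>h. h \<in> I \<and> h \<noteq> 0" p "degree_in v"] pI p by blast
          have multiple: "\<exists>c\<in>polys_in (S - {v}). c \<noteq> 0 \<and> (\<exists>s\<in>polys_in S. c * f = h * s)"
            if f: "f \<in> I" for f
          proof -
            obtain c s r where c: "c \<in> polys_in (S - {v})" "c \<noteq> 0" and s: "s \<in> polys_in S"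
              and eq: "c * f = h * s + r" and r: "r \<in> low_degree v (degree_in v h)"
              using pseudo_division[OF v I_S[OF f] I_S[OF h(1)] h(2)] by blast
            have "r = c * f - s * h" using eq by (simp add: mult.commute)
            then have "r \<in> I" using I_diff[OF f h(1)] c s SA by blast
            then have "r = 0" using h_min r by (metis leD low_degree_iff)
            then show ?thesis using c s eq by auto
          qed
          obtain c s where c: "c \<in> polys_in (S - {v})" "c \<noteq> 0" and s: "s \<in> polys_in S"
            and eq: "c * p = h * s"
            using multiple[OF pI] by blast
          obtain c1 c2 h' s' where c1: "c1 \<in> polys_in (S - {v})"
            and eqs: "h = c1 * h'" "s = c2 * s'" "p = h' * s'"
            using split_content[OF A c I_S[OF h(1)] s eq] by blast
          from irr[OF eqs(3)] consider "h' dvd 1" | "s' dvd 1" by blast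
          then show "p dvd b"
          proof cases
            case 1
            obtain x y where "h = x * p + y * a" using h by (auto simp: I_def)
            then have "h * b = p * (x * b) + y * (a * b)"
              by (simp add: algebra_simps)
            then have "p dvd h * b"
              using \<open>p dvd a * b\<close> by simp
            moreover have "h * b = h' * (c1 * b)"
              by (simp add: eqs)
            ultimately have dvd: "p dvd h' * (c1 * b)" by simp
            obtain e where e: "1 = h' * e" using 1 by blast
            have "h' * (c1 * b) * e = (h' * e) * (c1 * b)"
              by (simp only: mult.assoc mult.commute mult.left_commute)
            also have "\<dots> = c1 * b"
              by (simp flip: e)
            finally have "p dvd c1 * b"
              using dvd by (metis dvd_mult2)
            then show ?thesis
              using cancel[OF c1 _ b] h eqs by auto
          next
            case 2
            then have "p dvd h"
              by (simp add: eqs)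
            moreover obtain d t where "d \<in> polys_in (S - {v})" "d \<noteq> 0" "d * a = h * t"
              using multiple[OF aI] by blast
            ultimately have "p dvd a"
              using cancel a by (metis dvd_mult2)
            with \<open>\<not> p dvd a\<close> show ?thesis by simp
          qed
        qed
        then have "prime_in S p"
          using p unfolding prime_in_def by blast
        then show ?thesis using dvd_refl by blast
      qed
    qed
  qed
  then show ?thesis by (simp add: has_prime_factors_def)
qed

lemma has_prime_factors_finite:
  fixes S :: "'n::{finite,linorder} set"
  shows "has_prime_factors TYPE('k::field) S"
proof (induction S rule: finite_induct[OF finite])
  case 1
  have "p dvd 1" if p: "p \<in> polys_in {}" "p \<noteq> 0" for p :: "('n, 'k) mpoly"
  proof -
    have "p = const (lookup p 0)"
      using p(1) by (intro const_if_keys) (auto simp: polys_in_def)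
    then show ?thesis using p const_unit by (metis const_eq_0_iff)
  qed
  then show ?case by (auto simp: has_prime_factors_def)
next
  case (2 v S)
  then show ?case using has_prime_factors_extend[of "insert v S" v, where 'k='k] by simp
qed

lemma ex_prime_factor:
  fixes p :: "('n::{finite,linorder}, 'k::field) mpoly"
  assumes "p \<noteq> 0" "\<not> p dvd 1"
  shows "\<exists>q. prime_elem q \<and> q dvd p"
proof -
  obtain q where "prime_in UNIV q" "q dvd p"
    using has_prime_factors_finite[of "UNIV :: 'n set", where 'k='k] assms
    unfolding has_prime_factors_def by auto
  then show ?thesis
    unfolding prime_in_def prime_elem_def polys_in_UNIV by blast
qed

text \<open>
  The last hypothesis expresses that \<open>P\<close> has height one: it has no nonzero element free of \<open>v\<close>. A prime
  factor \<open>q\<close> in \<open>P\<close> of an element of least degree in \<open>v\<close> generates \<open>P\<close>: pseudo-division of \<open>p\<close> by \<open>q\<close>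
  leaves a remainder in \<open>P\<close> of smaller degree, which is zero, so \<open>q\<close> divides \<open>c * p\<close>, and it cannot
  divide \<open>c\<close>, which is free of \<open>v\<close> and so not in \<open>P\<close>.
\<close>

lemma prime_ideal_principal:
  fixes P :: "('n::{finite,linorder}, 'k::field) mpoly set"
  assumes diff: "\<And>p q. p \<in> P \<Longrightarrow> q \<in> P \<Longrightarrow> p - q \<in> P"
    and mult: "\<And>p q. p \<in> P \<Longrightarrow> q * p \<in> P"
    and prime: "\<And>p q. p * q \<in> P \<Longrightarrow> p \<in> P \<or> q \<in> P" and "1 \<notin> P"
    and nonzero: "g \<in> P" "g \<noteq> 0"
    and meet: "\<And>p. p \<in> P \<Longrightarrow> p \<in> polys_in (UNIV - {v}) \<Longrightarrow> p = 0"
  shows "\<exists>Q. Q \<noteq> 0 \<and> P = {Q * p | p. True}"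
proof -
  obtain h where h: "h \<in> P" "h \<noteq> 0"
    and h_min: "\<And>g. g \<in> P \<Longrightarrow> g \<noteq> 0 \<Longrightarrow> degree_in v h \<le> degree_in v g"
    using ex_has_least_nat[of "\<lambda>h. h \<in> P \<and> h \<noteq> 0" g "degree_in v"] nonzero by blast
  have "\<exists>q\<in>P. prime_elem q \<and> q dvd h"
    using h(1,2)
  proof (induction "nat (total_degree h)" arbitrary: h rule: less_induct)
    case less
    have "\<not> h dvd 1"
      using less.prems mult \<open>1 \<notin> P\<close> by (metis dvd_def mult.commute)
    then obtain q where q: "prime_elem q" "q dvd h"
      using ex_prime_factor less.prems by blast
    then obtain t where t: "h = q * t" by blast
    then have nz: "q \<noteq> 0" "t \<noteq> 0" using less.prems by auto
    show ?case
    proof (cases "q \<in> P")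
      case False
      then have "t \<in> P" using prime less.prems t by blast
      moreover have "nat (total_degree t) < nat (total_degree h)"
        using total_degree_nonunit[of q] total_degree_nonneg[of t] nz q(1)
        by (simp add: t wdeg_mult prime_elem_def)
      ultimately show ?thesis using less.hyps nz t by (metis dvd_mult)
    qed (use q in blast)
  qed
  then obtain q where q: "q \<in> P" "prime_elem q" "q dvd h" by blast
  then have "q \<noteq> 0" by auto
  have "q dvd p" if "p \<in> P" for p
  proof -
    obtain c s r where c: "c \<in> polys_in (UNIV - {v})" "c \<noteq> 0"
      and eq: "c * p = q * s + r" and r: "r \<in> low_degree v (degree_in v q)"
      using pseudo_division[of v UNIV p q] \<open>q \<noteq> 0\<close> by auto
    have "r = c * p - s * q" using eq by (simp add: mult.commute)
    then have "r \<in> P" using diff mult that q(1) by blast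
    have "degree_in v q \<le> degree_in v h"
      using q(3) h(2) by (auto simp: degree_in_mult)
    then have "r = 0"
      using h_min[OF \<open>r \<in> P\<close>] r by (metis le_trans leD low_degree_iff)
    then have "q dvd c * p" using eq by simp
    then consider "q dvd c" | "q dvd p"
      using q(2) by (auto simp: prime_elem_dvd_mult_iff)
    then show "q dvd p"
    proof cases
      case 1
      then have "c \<in> P" using mult[OF q(1)] by (auto simp: mult.commute)
      then show ?thesis using meet c by blast
    qed
  qed
  moreover have "q * p \<in> P" for p
    using mult[OF q(1), of p] by (simp add: mult.commute)
  ultimately have "P = {q * p | p. True}" by blast
  then show ?thesis using \<open>q \<noteq> 0\<close> by blast
qed

section \<open>Transcendence degree\<close>

interpretation coeff_space: vector_space "\<lambda>(c::'k::field) (y::('n::{finite,linorder}, 'k) ratfun). rconst c * y"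
  by unfold_locales (simp_all add: distrib_left distrib_right rconst.hom_add rconst.hom_mult mult.assoc)

definition generated_ring ::
    "('n::{finite,linorder}, 'k::field) ratfun set \<Rightarrow> ('n, 'k) ratfun set"
  where "generated_ring X = eval_mpoly rconst (\<lambda>x. x) ` polys_in X"

text \<open>
  The equation has coefficients in the ring generated by \<open>X\<close> rather than in its field of fractions, so
  that the leading coefficient \<open>a\<close> cannot be normalised to one. A degree \<open>d = 0\<close> is excluded by
  \<open>a \<noteq> 0\<close>.
\<close>

definition algebraic_over ::
    "('n::{finite,linorder}, 'k::field) ratfun set \<Rightarrow> ('n, 'k) ratfun \<Rightarrow> bool"
  where "algebraic_over X z \<longleftrightarrow> (\<exists>d a c. a \<in> generated_ring X \<and> a \<noteq> 0 \<and>
    (\<forall>t. c t \<in> generated_ring X) \<and> a * z ^ d = (\<Sum>t<d. c t * z ^ t))"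

lemma alg_indep_altdef:
  "alg_indep B \<longleftrightarrow> (\<forall>p\<in>polys_in B. eval_mpoly rconst (\<lambda>x. x) p = 0 \<longrightarrow> p = 0)"
  by (auto simp: alg_indep_def polys_in_def)

lemma as_univariate:
  fixes p :: "('v, 'k::comm_ring_1) mpoly"
  assumes "p \<in> polys_in (insert v S)" "v \<notin> S"
  obtains P where "\<And>t. coeff P t \<in> polys_in S" "poly P (Var v) = p"
proof
  define P where "P = (\<Sum>a\<in>keys p. monom (single (a - single v (lookup a v)) (lookup p a)) (lookup a v))"
  show "coeff P t \<in> polys_in S" for t
  proof -
    have "keys (a - single v (lookup a v)) \<subseteq> S" if "a \<in> keys p" for a
    proof
      fix i assume "i \<in> keys (a - single v (lookup a v))"
      then have "i \<noteq> v" "i \<in> keys a"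
        by (auto simp: in_keys_iff lookup_minus lookup_single when_def split: if_splits)
      then show "i \<in> S" using assms(1) that by (auto simp: polys_in_def)
    qed
    then show ?thesis
      unfolding P_def coeff_sum coeff_monom by (intro polys_in_sum) (auto simp: polys_in_single)
  qed
  have "poly P (Var v) = (\<Sum>a\<in>keys p. single a (lookup p a))"
    unfolding P_def poly_sum
  proof (intro sum.cong refl)
    fix a :: "'v \<Rightarrow>\<^sub>0 nat"
    have "a - single v (lookup a v) + single v (lookup a v) = a"
      by (intro poly_mapping_eqI) (auto simp: lookup_add lookup_minus lookup_single when_def)
    then show "poly (monom (single (a - single v (lookup a v)) (lookup p a)) (lookup a v)) (Var v) =
        single a (lookup p a)"
      by (simp add: poly_monom Var_power mult_single)
  qed
  then show "poly P (Var v) = p" by (simp only: sum_of_monomials)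
qed

lemma algebraic_over_member:
  fixes z :: "('n::{finite,linorder}, 'k::field) ratfun"
  assumes "z \<in> X"
  shows "algebraic_over X z"
proof -
  have "1 \<in> generated_ring X"
    unfolding generated_ring_def by (rule image_eqI[of _ _ 1]) simp_all
  moreover have "z \<in> generated_ring X"
    unfolding generated_ring_def
    by (rule image_eqI[of _ _ "Var z"]) (simp_all add: assms polys_in_Var)
  moreover have "1 * z ^ 1 = (\<Sum>t<1. z * z ^ t)" by simp
  ultimately show ?thesis
    unfolding algebraic_over_def
    by (intro exI[of _ 1] exI[of _ "1 :: ('n, 'k) ratfun"] exI[of _ "\<lambda>_. z"]) simp
qed

lemma algebraic_over_if_dependent:
  assumes X: "alg_indep X" and z: "\<not> alg_indep (insert z X)"
  shows "algebraic_over X z"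
proof -
  let ?ev = "eval_mpoly rconst (\<lambda>x. x)"
  have "z \<notin> X" using X z by (metis insert_absorb)
  obtain p where p: "p \<in> polys_in (insert z X)" "?ev p = 0" "p \<noteq> 0"
    using z by (auto simp: alg_indep_altdef)
  obtain P where P: "\<And>t. coeff P t \<in> polys_in X" "poly P (Var z) = p"
    using as_univariate[OF p(1) \<open>z \<notin> X\<close>] by metis
  let ?d = "degree P"
  have "P \<noteq> 0" using P(2) p(3) by auto
  then have lc: "?ev (coeff P ?d) \<noteq> 0"
    using X P(1)[of ?d] by (auto simp: alg_indep_altdef)
  have "?ev p = (\<Sum>t\<le>?d. ?ev (coeff P t) * z ^ t)"
    by (simp add: P(2)[symmetric] poly_altdef rconst.eval_sum rconst.eval_mult rconst.eval_power)
  also have "\<dots> = ?ev (coeff P ?d) * z ^ ?d + (\<Sum>t<?d. ?ev (coeff P t) * z ^ t)"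
    by (simp flip: lessThan_Suc_atMost)
  finally have "?ev (coeff P ?d) * z ^ ?d = (\<Sum>t<?d. ?ev (- coeff P t) * z ^ t)"
    using p(2) by (simp add: rconst.eval_uminus sum_negf eq_neg_iff_add_eq_0)
  moreover have "?ev (coeff P ?d) \<in> generated_ring X" "\<And>t. ?ev (- coeff P t) \<in> generated_ring X"
    using P(1) by (auto simp: generated_ring_def polys_in_uminus)
  ultimately show ?thesis
    using lc unfolding algebraic_over_def
    by (intro exI[of _ ?d] exI[of _ "?ev (coeff P ?d)"] exI[of _ "\<lambda>t. ?ev (- coeff P t)"]) blast
qed

text \<open>
  A family \<open>Z\<close> that is algebraic over the finite set \<open>X\<close>. The aim is that the field generated by \<open>Z\<close> holds
  at most \<open>card X\<close> algebraically independent elements, and it is reached by counting dimensions over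
  \<open>k\<close>. The spaces \<open>W N\<close> below, spanned by products of monomials in \<open>X\<close> with exponents up to \<open>N\<close> and
  monomials in \<open>Z\<close> with exponents below the degrees of the equations, grow at most like
  \<open>N ^ card X\<close>. A
  multiplier is an element that maps \<open>W N\<close> into \<open>W (N + C)\<close> for all \<open>N\<close>.
\<close>

locale algebraic_family =
  fixes X Z :: "('n::{finite,linorder}, 'k::field) ratfun set"
    and d :: "('n, 'k) ratfun \<Rightarrow> nat"
    and a :: "('n, 'k) ratfun \<Rightarrow> ('n, 'k) ratfun"
    and c :: "('n, 'k) ratfun \<Rightarrow> nat \<Rightarrow> ('n, 'k) ratfun"
  assumes finite_X: "finite X" and finite_Z: "finite Z"
    and a: "z \<in> Z \<Longrightarrow> a z \<in> generated_ring X" "z \<in> Z \<Longrightarrow> a z \<noteq> 0"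
    and c: "z \<in> Z \<Longrightarrow> c z t \<in> generated_ring X"
    and relation: "z \<in> Z \<Longrightarrow> a z * z ^ d z = (\<Sum>t<d z. c z t * z ^ t)"
begin

definition monomials :: "nat \<Rightarrow> ('n, 'k) ratfun set"
  where "monomials N = {(\<Prod>x\<in>X. x ^ \<alpha> x) * (\<Prod>z\<in>Z. z ^ \<beta> z) | \<alpha> \<beta>.
    (\<forall>x\<in>X. \<alpha> x \<le> N) \<and> (\<forall>z\<in>Z. \<beta> z < d z)}"

definition W :: "nat \<Rightarrow> ('n, 'k) ratfun set"
  where "W N = coeff_space.span (monomials N)"

definition multipliers :: "nat \<Rightarrow> ('n, 'k) ratfun set"
  where "multipliers C = {y. \<forall>N. \<forall>u\<in>W N. y * u \<in> W (N + C)}"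

lemma d_pos: "z \<in> Z \<Longrightarrow> 0 < d z"
  using relation[of z] a(2)[of z] by (cases "d z = 0") auto

lemma finite_card_monomials:
  "finite (monomials N) \<and> card (monomials N) \<le> (N + 1) ^ card X * (\<Prod>z\<in>Z. d z)"
proof -
  let ?E = "(\<Pi>\<^sub>E x\<in>X. {..N}) \<times> (\<Pi>\<^sub>E z\<in>Z. {..<d z})"
  let ?f = "\<lambda>(\<alpha>, \<beta>). (\<Prod>x\<in>X. x ^ \<alpha> x) * (\<Prod>z\<in>Z. z ^ \<beta> z)"
  have "monomials N \<subseteq> ?f ` ?E"
  proof
    fix m assume "m \<in> monomials N"
    then obtain \<alpha> \<beta> where m: "m = (\<Prod>x\<in>X. x ^ \<alpha> x) * (\<Prod>z\<in>Z. z ^ \<beta> z)"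
      and le: "\<forall>x\<in>X. \<alpha> x \<le> N" "\<forall>z\<in>Z. \<beta> z < d z"
      by (auto simp: monomials_def)
    have "m = ?f (restrict \<alpha> X, restrict \<beta> Z)"
      by (simp add: m)
    moreover have "(restrict \<alpha> X, restrict \<beta> Z) \<in> ?E"
      using le by auto
    ultimately show "m \<in> ?f ` ?E" by (rule image_eqI)
  qed
  moreover have "finite ?E"
    using finite_X finite_Z by (simp add: finite_PiE)
  moreover have "card ?E = (N + 1) ^ card X * (\<Prod>z\<in>Z. d z)"
    using finite_X finite_Z by (simp add: card_cartesian_product card_PiE)
  ultimately show ?thesis
    using card_mono[of "?f ` ?E" "monomials N"] card_image_le[of ?E ?f]
    by (auto intro: finite_subset)
qed

lemma W_mono: "M \<le> N \<Longrightarrow> u \<in> W M \<Longrightarrow> u \<in> W N"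
proof -
  assume "M \<le> N"
  then have "monomials M \<subseteq> monomials N"
    unfolding monomials_def by (blast intro: le_trans)
  then show "u \<in> W M \<Longrightarrow> u \<in> W N"
    unfolding W_def using coeff_space.span_mono by blast
qed

lemma W_sum: "(\<And>i. i \<in> A \<Longrightarrow> f i \<in> W N) \<Longrightarrow> sum f A \<in> W N"
  unfolding W_def by (rule coeff_space.span_sum)

lemma one_in_W: "1 \<in> W 0"
proof -
  have "1 = (\<Prod>x\<in>X. x ^ 0) * (\<Prod>z\<in>Z. z ^ 0)" by simp
  then have "1 \<in> monomials 0"
    unfolding monomials_def using d_pos
    by (intro CollectI exI[of _ "\<lambda>_. 0"] conjI ballI) simp_all
  then show ?thesis
    unfolding W_def by (rule coeff_space.span_base)
qed

lemma multipliersI: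
  assumes "\<And>N m. m \<in> monomials N \<Longrightarrow> y * m \<in> W (N + C)"
  shows "y \<in> multipliers C"
  unfolding multipliers_def
proof clarify
  fix N u assume "u \<in> W N"
  then show "y * u \<in> W (N + C)"
    unfolding W_def
  proof (induction rule: coeff_space.span_induct_alt)
    case base
    show ?case by (simp add: coeff_space.span_zero)
  next
    case (step r m v)
    have "rconst r * (y * m) + y * v \<in> coeff_space.span (monomials (N + C))"
      using step assms[of m N, unfolded W_def]
      by (intro coeff_space.span_add coeff_space.span_scale) auto
    then show ?case by (simp add: algebra_simps)
  qed
qed

lemma multipliers_mono: "C \<le> C' \<Longrightarrow> y \<in> multipliers C \<Longrightarrow> y \<in> multipliers C'"
  unfolding multipliers_def using W_mono[of "N + C" "N + C'" for N] by simp

lemma multipliers_mult: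
  assumes "y \<in> multipliers C" "y' \<in> multipliers C'"
  shows "y * y' \<in> multipliers (C + C')"
  unfolding multipliers_def
proof clarify
  fix N u assume "u \<in> W N"
  with assms have "y * (y' * u) \<in> W (N + C' + C)"
    unfolding multipliers_def by blast
  then show "y * y' * u \<in> W (N + (C + C'))"
    by (simp add: ac_simps)
qed

lemma multipliers_add:
  assumes "y \<in> multipliers C" "y' \<in> multipliers C"
  shows "y + y' \<in> multipliers C"
  using assms unfolding multipliers_def W_def by (auto simp: distrib_right intro: coeff_space.span_add)

lemma multipliers_const: "rconst r \<in> multipliers 0"
  unfolding multipliers_def W_def by (auto intro: coeff_space.span_scale)

lemma multipliers_power: "y \<in> multipliers C \<Longrightarrow> y ^ n \<in> multipliers (n * C)"
proof (induction n)
  case 0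
  show ?case using multipliers_const[of 1] by simp
qed (auto intro: multipliers_mult)

lemma multipliers_prod:
  "(\<And>i. i \<in> A \<Longrightarrow> f i \<in> multipliers (C i)) \<Longrightarrow> prod f A \<in> multipliers (sum C A)"
proof (induction A rule: infinite_finite_induct)
  case (insert i A)
  then show ?case by (simp add: multipliers_mult)
qed (use multipliers_const[of 1] in simp_all)

lemma generator_in_multipliers:
  assumes x: "x \<in> X"
  shows "x \<in> multipliers 1"
proof (rule multipliersI)
  fix N m assume "m \<in> monomials N"
  then obtain \<alpha> \<beta> where m: "m = (\<Prod>x\<in>X. x ^ \<alpha> x) * (\<Prod>z\<in>Z. z ^ \<beta> z)"
    and le: "\<forall>x\<in>X. \<alpha> x \<le> N" "\<forall>z\<in>Z. \<beta> z < d z"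
    by (auto simp: monomials_def)
  let ?\<alpha> = "\<alpha>(x := Suc (\<alpha> x))"
  have "(\<Prod>y\<in>X. y ^ ?\<alpha> y) = x ^ Suc (\<alpha> x) * (\<Prod>y\<in>X - {x}. y ^ \<alpha> y)"
    using prod.remove[OF finite_X x, of "\<lambda>y. y ^ ?\<alpha> y"] by simp
  also have "\<dots> = x * (\<Prod>y\<in>X. y ^ \<alpha> y)"
    using prod.remove[OF finite_X x, of "\<lambda>y. y ^ \<alpha> y"] by (simp add: mult.assoc)
  finally have "x * m = (\<Prod>y\<in>X. y ^ ?\<alpha> y) * (\<Prod>z\<in>Z. z ^ \<beta> z)"
    by (simp add: m mult.assoc)
  moreover have "\<forall>y\<in>X. ?\<alpha> y \<le> N + 1"
    using le by (auto simp: le_SucI)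
  ultimately have "x * m \<in> monomials (N + 1)"
    unfolding monomials_def using le by blast
  then show "x * m \<in> W (N + 1)"
    unfolding W_def by (rule coeff_space.span_base)
qed

lemma generated_ring_multipliers:
  assumes "y \<in> generated_ring X"
  shows "\<exists>C. y \<in> multipliers C"
proof -
  obtain p where p: "p \<in> polys_in X" and y: "y = eval_mpoly rconst (\<lambda>x. x) p"
    using assms by (auto simp: generated_ring_def)
  show ?thesis
    unfolding y using p
  proof (induction rule: polys_in_induct)
    case (const c)
    then show ?case using multipliers_const by auto
  next
    case (Var v)
    then show ?case using generator_in_multipliers by auto
  next
    case (add p q)
    then obtain C C' where
      "eval_mpoly rconst (\<lambda>x. x) p \<in> multipliers C" "eval_mpoly rconst (\<lambda>x. x) q \<in> multipliers C'"
      by blast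
    then have "eval_mpoly rconst (\<lambda>x. x) (p + q) \<in> multipliers (C + C')"
      unfolding rconst.eval_add
      using multipliers_mono[of C "C + C'"] multipliers_mono[of C' "C + C'"]
      by (intro multipliers_add) auto
    then show ?case by blast
  next
    case (mult p q)
    then show ?case unfolding rconst.eval_mult by (blast intro: multipliers_mult)
  qed
qed

text \<open>
  An exponent of \<open>z\<close> that reaches the degree of its equation is reduced by that equation, at the price
  of the factor \<open>a z\<close> and of the coefficients, which lie in the ring generated by \<open>X\<close>.
\<close>

lemma algebraic_in_multipliers:
  assumes z: "z \<in> Z"
  shows "\<exists>C. a z * z \<in> multipliers C"
proof -
  obtain Ca where Ca: "a z \<in> multipliers Ca"
    using generated_ring_multipliers a(1) z by blast
  have "\<forall>t. \<exists>C. c z t \<in> multipliers C"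
    using generated_ring_multipliers c z by blast
  then obtain Cc where Cc: "\<And>t. c z t \<in> multipliers (Cc t)"
    by metis
  define C where "C = Ca + (\<Sum>t<d z. Cc t)"
  have "a z * z \<in> multipliers C"
  proof (rule multipliersI)
    fix N m assume "m \<in> monomials N"
    then obtain \<alpha> \<beta> where m: "m = (\<Prod>x\<in>X. x ^ \<alpha> x) * (\<Prod>z\<in>Z. z ^ \<beta> z)"
      and le: "\<forall>x\<in>X. \<alpha> x \<le> N" "\<forall>z\<in>Z. \<beta> z < d z"
      by (auto simp: monomials_def)
    define R where "R = (\<Prod>x\<in>X. x ^ \<alpha> x) * (\<Prod>y\<in>Z - {z}. y ^ \<beta> y)"
    have upd: "z ^ t * R = (\<Prod>x\<in>X. x ^ \<alpha> x) * (\<Prod>y\<in>Z. y ^ (\<beta>(z := t)) y)" for t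
    proof -
      have "(\<Prod>y\<in>Z. y ^ (\<beta>(z := t)) y) = z ^ t * (\<Prod>y\<in>Z - {z}. y ^ \<beta> y)"
        using prod.remove[OF finite_Z z, of "\<lambda>y. y ^ (\<beta>(z := t)) y"] by simp
      then show ?thesis by (simp add: R_def)
    qed
    have in_W: "z ^ t * R \<in> W N" if "t < d z" for t
    proof -
      have "\<forall>y\<in>Z. (\<beta>(z := t)) y < d y"
        using le that by simp
      then have "z ^ t * R \<in> monomials N"
        unfolding monomials_def upd using le by blast
      then show ?thesis unfolding W_def by (rule coeff_space.span_base)
    qed
    have m_R: "m = z ^ \<beta> z * R"
      using upd[of "\<beta> z"] by (simp add: m)
    show "a z * z * m \<in> W (N + C)"
    proof (cases "Suc (\<beta> z) < d z")
      case True
      then have "a z * (z ^ Suc (\<beta> z) * R) \<in> W (N + Ca)"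
        using Ca in_W unfolding multipliers_def by blast
      then show ?thesis
        using W_mono[of "N + Ca" "N + C"] by (simp add: m_R C_def mult.assoc)
    next
      case False
      with le z have "d z = Suc (\<beta> z)" by (metis Suc_lessI)
      then have "a z * z * m = a z * z ^ d z * R"
        by (simp add: m_R mult.assoc)
      also have "\<dots> = (\<Sum>t<d z. c z t * (z ^ t * R))"
        by (simp add: relation[OF z] sum_distrib_right mult.assoc)
      also have "\<dots> \<in> W (N + C)"
      proof (rule W_sum)
        fix t assume t: "t \<in> {..<d z}"
        then have "Cc t \<le> C"
          unfolding C_def by (intro trans_le_add2 member_le_sum) auto
        then have "N + Cc t \<le> N + C" by simp
        moreover have "c z t * (z ^ t * R) \<in> W (N + Cc t)"
          using Cc in_W t unfolding multipliers_def by blast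
        ultimately show "c z t * (z ^ t * R) \<in> W (N + C)"
          by (rule W_mono)
      qed
      finally show ?thesis .
    qed
  qed
  then show ?thesis by blast
qed

text \<open>
  Multipliers form a ring, so their quotients form a field; it contains each \<open>z\<close> as the quotient of
  \<open>a z * z\<close> by \<open>a z\<close>.
\<close>

lemma hull_quotients_of_multipliers:
  assumes "y \<in> is_subfield hull Z"
  shows "\<exists>s C. s \<noteq> 0 \<and> s \<in> multipliers C \<and> s * y \<in> multipliers C"
proof -
  define F where "F = {y. \<exists>s C. s \<noteq> 0 \<and> s \<in> multipliers C \<and> s * y \<in> multipliers C}"
  have F_I: "y \<in> F" if "s \<noteq> 0" "s \<in> multipliers C" "s * y \<in> multipliers C'" for s C C' y
    unfolding F_def using that multipliers_mono[of C "C + C'" s] multipliers_mono[of C' "C + C'" "s * y"]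
    by auto
  have "is_subfield F"
    unfolding is_subfield_def
  proof (intro conjI allI ballI)
    show "rconst r \<in> F" for r
      using F_I[of 1 0 "rconst r" 0] multipliers_const[of 1] multipliers_const[of r] by simp
    fix x y assume "x \<in> F" "y \<in> F"
    then obtain s C t B where s: "s \<noteq> 0" "s \<in> multipliers C" "s * x \<in> multipliers C"
      and t: "t \<noteq> 0" "t \<in> multipliers B" "t * y \<in> multipliers B"
      by (auto simp: F_def)
    have st: "s * t \<noteq> 0" "s * t \<in> multipliers (C + B)"
      using s t by (auto intro: multipliers_mult)
    have "(s * x) * t + s * (t * y) \<in> multipliers (C + B)"
      using s t by (intro multipliers_add multipliers_mult)
    then show "x + y \<in> F"
      using F_I[OF st, of "x + y" "C + B"] by (simp add: algebra_simps)
    have "(s * x) * (t * y) \<in> multipliers (C + B)"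
      using s t by (intro multipliers_mult)
    then show "x * y \<in> F"
      using F_I[OF st, of "x * y" "C + B"] by (simp add: ac_simps)
    show "inverse x \<in> F"
    proof (cases "x = 0")
      case True
      then show ?thesis using \<open>x \<in> F\<close> by simp
    next
      case False
      then have eq: "s * x * inverse x = s" by simp
      have "s * x * inverse x \<in> multipliers C"
        unfolding eq by (rule s(2))
      with s False show ?thesis
        by (intro F_I[of "s * x" C _ C]) simp_all
    qed
  qed
  moreover have "Z \<subseteq> F"
  proof
    fix z assume z: "z \<in> Z"
    obtain C where "a z \<in> multipliers C"
      using generated_ring_multipliers a(1) z by blast
    moreover obtain C' where "a z * z \<in> multipliers C'"
      using algebraic_in_multipliers z by blast
    ultimately show "z \<in> F"
      using F_I a(2) z by blast
  qed
  ultimately have "is_subfield hull Z \<subseteq> F"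
    by (intro hull_minimal)
  with assms show ?thesis by (auto simp: F_def)
qed

text \<open>
  With a common denominator \<open>s\<close> of the elements of \<open>T\<close>, the \<open>(N + 1) ^ card T\<close> products of
  \<open>s ^ (card T * N)\<close> with the monomials in \<open>T\<close> with exponents up to \<open>N\<close> are linearly independent and lie in
  \<open>W (card T * N * C)\<close>, whose dimension is bounded by a constant times \<open>(N + 1) ^ card X\<close>.
\<close>

lemma card_le_if_alg_indep:
  assumes T: "finite T" "T \<subseteq> is_subfield hull Z" "alg_indep T"
  shows "card T \<le> card X"
proof (rule ccontr)
  assume "\<not> card T \<le> card X"
  then have less: "Suc (card X) \<le> card T" by simp
  let ?ev = "eval_mpoly rconst (\<lambda>x. x)"
  have "\<forall>t\<in>T. \<exists>s C. s \<noteq> 0 \<and> s \<in> multipliers C \<and> s * t \<in> multipliers C"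
    using T(2) hull_quotients_of_multipliers by blast
  then obtain s' C' where s': "\<And>t. t \<in> T \<Longrightarrow> s' t \<noteq> 0" "\<And>t. t \<in> T \<Longrightarrow> s' t \<in> multipliers (C' t)"
    "\<And>t. t \<in> T \<Longrightarrow> s' t * t \<in> multipliers (C' t)"
    by metis
  define s where "s = (\<Prod>t\<in>T. s' t)"
  define C where "C = (\<Sum>t\<in>T. C' t)"
  have s: "s \<noteq> 0" "s \<in> multipliers C"
    unfolding s_def C_def using T(1) s' by (auto intro: multipliers_prod)
  have st: "s * t \<in> multipliers C" if "t \<in> T" for t
  proof -
    have "(s' t * t) * (\<Prod>t\<in>T - {t}. s' t) \<in> multipliers (C' t + (\<Sum>t\<in>T - {t}. C' t))"
      using that s' by (intro multipliers_mult multipliers_prod) auto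
    then show ?thesis
      using prod.remove[OF T(1) that, of s'] sum.remove[OF T(1) that, of C']
      by (simp add: s_def C_def ac_simps)
  qed
  let ?m = "card T"
  define expo where "expo = (\<lambda>\<alpha>. \<Sum>t\<in>T. single t (\<alpha> t :: nat))"
  have lookup_expo: "lookup (expo \<alpha>) t = (if t \<in> T then \<alpha> t else 0)" for \<alpha> t
    using T(1) by (simp add: expo_def lookup_sum lookup_single when_def sum.delta)
  have keys_expo: "keys (expo \<alpha>) \<subseteq> T" for \<alpha>
    by (auto simp: in_keys_iff lookup_expo split: if_splits)
  define E where "E N = expo ` (\<Pi>\<^sub>E t\<in>T. {..N})" for N
  have fin_E: "finite (E N)" for N
    unfolding E_def using T(1) by (intro finite_imageI finite_PiE) auto
  have card_E: "card (E N) = (N + 1) ^ ?m" for N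
  proof -
    have "inj_on expo (\<Pi>\<^sub>E t\<in>T. {..N})"
    proof (rule inj_onI)
      fix \<alpha> \<beta> assume \<alpha>\<beta>: "\<alpha> \<in> (\<Pi>\<^sub>E t\<in>T. {..N})" "\<beta> \<in> (\<Pi>\<^sub>E t\<in>T. {..N})"
        and "expo \<alpha> = expo \<beta>"
      then have "\<alpha> t = \<beta> t" if "t \<in> T" for t
        using lookup_expo[of \<alpha> t] lookup_expo[of \<beta> t] that by simp
      with \<alpha>\<beta> show "\<alpha> = \<beta>" by (rule PiE_ext)
    qed
    then show ?thesis
      unfolding E_def using T(1) by (simp add: card_image card_PiE)
  qed
  have keys_E: "keys e \<subseteq> T" if "e \<in> E N" for e N
    using that keys_expo by (auto simp: E_def)
  have lookup_E: "lookup e t \<le> N" if "e \<in> E N" for e N t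
    using that by (auto simp: E_def lookup_expo)
  define mv where "mv = monomial_value (\<lambda>x::('n, 'k) ratfun. x)"
  have mv_inj: "e = e'" if "keys e \<subseteq> T" "keys e' \<subseteq> T" "mv e = mv e'" for e e'
  proof -
    have "?ev (single e 1 - single e' 1) = 0"
      using that(3) by (simp add: rconst.eval_diff rconst.eval_single mv_def)
    moreover have "single e 1 - single e' (1::'k) \<in> polys_in T"
      using that by (intro polys_in_diff polys_in_single)
    ultimately have "single e 1 - single e' (1::'k) = 0"
      using T(3) by (auto simp: alg_indep_altdef)
    then have "lookup (single e (1::'k)) e = lookup (single e' 1) e" by simp
    then show ?thesis by (auto simp: lookup_single when_def split: if_splits)
  qed
  let ?K = "\<Prod>z\<in>Z. d z"
  have bound: "(N + 1) ^ ?m \<le> (?m * (N * C) + 1) ^ card X * ?K" for N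
  proof -
    let ?M = "?m * (N * C)"
    define f where "f e = s ^ (?m * N) * mv e" for e
    have f_W: "f e \<in> W ?M" if e: "e \<in> E N" for e
    proof -
      have "s ^ (N - lookup e t) * (s * t) ^ lookup e t \<in> multipliers (N * C)" if "t \<in> T" for t
      proof -
        have "s ^ (N - lookup e t) * (s * t) ^ lookup e t \<in>
            multipliers ((N - lookup e t) * C + lookup e t * C)"
          using s st[OF that] by (intro multipliers_mult multipliers_power)
        then show ?thesis
          using lookup_E[OF e, of t] by (simp flip: distrib_right)
      qed
      then have "(\<Prod>t\<in>T. s ^ (N - lookup e t) * (s * t) ^ lookup e t) \<in> multipliers (\<Sum>t\<in>T. N * C)"
        by (rule multipliers_prod)
      moreover have "(\<Prod>t\<in>T. s ^ (N - lookup e t) * (s * t) ^ lookup e t) = (\<Prod>t\<in>T. s ^ N * t ^ lookup e t)"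
        using lookup_E[OF e]
        by (intro prod.cong refl) (simp add: power_mult_distrib mult.assoc[symmetric] flip: power_add)
      moreover have "(\<Prod>t\<in>T. s ^ N * t ^ lookup e t) = f e"
        using monomial_value_superset[OF T(1) keys_E[OF e], of "\<lambda>x. x"]
        by (simp add: f_def mv_def prod.distrib power_mult[symmetric] mult.commute)
      ultimately have "f e \<in> multipliers ?M" by simp
      then have "f e * 1 \<in> W (0 + ?M)"
        using one_in_W unfolding multipliers_def by blast
      then show ?thesis by simp
    qed
    have inj: "inj_on f (E N)"
      using s mv_inj keys_E by (auto simp: inj_on_def f_def)
    have "\<not> coeff_space.dependent (f ` E N)"
    proof
      assume "coeff_space.dependent (f ` E N)"
      then obtain u where u: "\<exists>v\<in>f ` E N. u v \<noteq> 0" "(\<Sum>v\<in>f ` E N. rconst (u v) * v) = 0"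
        using coeff_space.dependent_finite[of "f ` E N"] fin_E by auto
      define p where "p = (\<Sum>e\<in>E N. single e (u (f e)))"
      have "s ^ (?m * N) * ?ev p = (\<Sum>e\<in>E N. rconst (u (f e)) * f e)"
        by (simp add: p_def rconst.eval_sum rconst.eval_single sum_distrib_left f_def mv_def ac_simps)
      also have "\<dots> = 0"
        using u(2) by (simp add: sum.reindex[OF inj])
      finally have "?ev p = 0" using s by simp
      moreover have "p \<in> polys_in T"
        unfolding p_def using keys_E by (intro polys_in_sum polys_in_single)
      ultimately have "p = 0" using T(3) by (auto simp: alg_indep_altdef)
      have "u (f e) = 0" if "e \<in> E N" for e
      proof -
        have "lookup p e = u (f e)"
          using that fin_E by (simp add: p_def lookup_sum lookup_single when_def sum.delta)
        then show ?thesis using \<open>p = 0\<close> by simp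
      qed
      with u(1) show False by blast
    qed
    then have "card (f ` E N) \<le> card (monomials ?M)"
      using coeff_space.independent_span_bound[of "monomials ?M" "f ` E N"] finite_card_monomials f_W
      by (auto simp: W_def)
    then show ?thesis
      using finite_card_monomials[of ?M] by (simp add: card_image[OF inj] card_E)
  qed
  \<comment> \<open>the constant that relates the dimension of \<open>W\<close> to \<open>(N + 1) ^ card X\<close>; an \<open>N\<close> this large
    makes one extra factor \<open>N + 1\<close> too much\<close>
  define N where "N = (?m * C + 1) ^ card X * ?K"
  have "?m * (N * C) + 1 \<le> (?m * C + 1) * (N + 1)"
    by (simp add: algebra_simps)
  then have "(?m * (N * C) + 1) ^ card X \<le> ((?m * C + 1) * (N + 1)) ^ card X"
    by (rule power_mono) simp
  then have "(N + 1) ^ ?m \<le> ((?m * C + 1) * (N + 1)) ^ card X * ?K"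
    using bound[of N] by (meson le_trans mult_le_mono1)
  also have "\<dots> = (N + 1) ^ card X * ((?m * C + 1) ^ card X * ?K)"
    by (simp only: power_mult_distrib mult.assoc mult.commute mult.left_commute)
  also have "\<dots> = (N + 1) ^ card X * N"
    by (simp only: N_def)
  also have "\<dots> < (N + 1) ^ Suc (card X)"
    by simp
  also have "\<dots> \<le> (N + 1) ^ ?m"
    using less by (intro power_increasing) auto
  finally show False by simp
qed

end

lemma card_alg_indep_le:
  assumes "finite X" "finite Z" "\<And>z. z \<in> Z \<Longrightarrow> algebraic_over X z"
    and "finite T" "T \<subseteq> is_subfield hull Z" "alg_indep T"
  shows "card T \<le> card X"
proof -
  have "\<forall>z. \<exists>r. z \<in> Z \<longrightarrow> (case r of (d, a, c) \<Rightarrow> a \<in> generated_ring X \<and> a \<noteq> 0 \<and>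
      (\<forall>t. c t \<in> generated_ring X) \<and> a * z ^ d = (\<Sum>t<d. c t * z ^ t))"
    using assms(3) by (simp add: algebraic_over_def)
  then obtain r where r: "\<And>z. z \<in> Z \<Longrightarrow> case r z of (d, a, c) \<Rightarrow> a \<in> generated_ring X \<and> a \<noteq> 0 \<and>
      (\<forall>t. c t \<in> generated_ring X) \<and> a * z ^ d = (\<Sum>t<d. c t * z ^ t)"
    using choice[of "\<lambda>z r. z \<in> Z \<longrightarrow> (case r of (d, a, c) \<Rightarrow> a \<in> generated_ring X \<and> a \<noteq> 0 \<and>
      (\<forall>t. c t \<in> generated_ring X) \<and> a * z ^ d = (\<Sum>t<d. c t * z ^ t))"] by blast
  define d a c where "d = (\<lambda>z. fst (r z))" and "a = (\<lambda>z. fst (snd (r z)))"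
    and "c = (\<lambda>z. snd (snd (r z)))"
  have fam: "a z \<in> generated_ring X" "a z \<noteq> 0" "c z t \<in> generated_ring X"
      "a z * z ^ d z = (\<Sum>t<d z. c z t * z ^ t)" if "z \<in> Z" for z t
    using r[OF that] by (simp_all add: d_def a_def c_def case_prod_beta)
  interpret algebraic_family X Z d a c
    by unfold_locales (fact assms(1,2) fam)+
  show ?thesis using card_le_if_alg_indep assms by blast
qed

lemma alg_indep_empty: "alg_indep {}"
  unfolding alg_indep_altdef
proof clarify
  fix p :: "(('n::{finite,linorder}, 'k::field) ratfun, 'k) mpoly"
  assume p: "p \<in> polys_in {}" "eval_mpoly rconst (\<lambda>x. x) p = 0"
  have "p = const (lookup p 0)"
    using p(1) by (intro const_if_keys) (auto simp: polys_in_def)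
  moreover from this have "rconst (lookup p 0) = (0 :: ('n, 'k) ratfun)"
    using p(2) by (metis rconst.eval_const)
  ultimately show "p = 0"
    by (simp add: rconst_def)
qed

lemma eval_rename:
  "eval_mpoly rconst g (eval_mpoly const (\<lambda>v. Var (h v)) p) = eval_mpoly rconst (\<lambda>v. g (h v)) p"
  by (simp add: rconst.eval_substitute)

text \<open>
  A maximal independent subset of \<open>range g\<close> and the given transcendence basis are algebraic over each
  other, so both have \<open>CARD('n) - 1\<close> elements; the subset is the injective image of all indices but one, \<open>v\<close>.
  The relation \<open>p\<close> arises either because \<open>g v\<close> repeats a value or because \<open>g v\<close> depends on the
  others.
\<close>

lemma trdeg_relations:
  fixes g :: "'n::{finite,linorder} \<Rightarrow> ('n, 'k::field) ratfun"
  assumes "has_trdeg (is_subfield hull (range g)) (CARD('n) - 1)"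
  obtains p v where "p \<noteq> 0" "eval_mpoly rconst g p = 0"
    "\<And>q. q \<in> polys_in (UNIV - {v}) \<Longrightarrow> eval_mpoly rconst g q = 0 \<Longrightarrow> q = 0"
proof -
  let ?K = "is_subfield hull (range g)"
  obtain B where B: "B \<subseteq> ?K" "alg_indep B" "finite B" "card B = CARD('n) - 1"
    and B_max: "\<And>x. x \<in> ?K \<Longrightarrow> x \<notin> B \<Longrightarrow> \<not> alg_indep (insert x B)"
    using assms by (auto simp: has_trdeg_def transcendence_basis_def)
  have g_K: "range g \<subseteq> ?K" by (rule hull_subset)
  have B_alg: "algebraic_over B z" if "z \<in> ?K" for z
    using that algebraic_over_member[of z B] algebraic_over_if_dependent[OF B(2)] B_max
    by blast
  have "card G \<le> CARD('n)" if "G \<subseteq> range g" for G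
    using that by (meson card_image_le card_mono finite finite_imageI le_trans)
  then have "\<exists>G. (G \<subseteq> range g \<and> alg_indep G) \<and>
      (\<forall>H. H \<subseteq> range g \<and> alg_indep H \<longrightarrow> card H \<le> card G)"
    by (intro ex_has_greatest_nat[of _ "{}" _ "Suc CARD('n)"])
      (auto simp: alg_indep_empty less_Suc_eq_le)
  then obtain G where G: "G \<subseteq> range g" "alg_indep G"
    and G_max: "\<And>H. H \<subseteq> range g \<Longrightarrow> alg_indep H \<Longrightarrow> card H \<le> card G"
    by blast
  have fin_G: "finite G" using G(1) by (rule finite_subset) simp
  have G_ins: "\<not> alg_indep (insert z G)" if "z \<in> range g" "z \<notin> G" for z
    using G_max[of "insert z G"] that G(1) fin_G by auto
  have G_alg: "algebraic_over G z" if "z \<in> range g" for z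
    using that algebraic_over_member[of z G] algebraic_over_if_dependent[OF G(2)] G_ins by blast
  have "card B \<le> card G"
    using card_alg_indep_le[OF fin_G _ G_alg B(3,1,2)] by simp
  moreover have "card G \<le> card B"
    using card_alg_indep_le[OF B(3) _ B_alg fin_G _ G(2), of "range g"] g_K G(1) by auto
  ultimately have card_G: "card G = CARD('n) - 1" using B(4) by simp
  obtain I where I: "inj_on g I" "G = g ` I"
    using G(1) by (auto simp: subset_image_inj)
  have "card I = CARD('n) - 1" using card_G I by (simp add: card_image)
  moreover have "0 < CARD('n)" by simp
  ultimately have "card (UNIV - I) = 1"
    by (simp add: card_Diff_subset)
  then obtain v where v: "UNIV - I = {v}" by (auto simp: card_1_singleton_iff)
  then have I_eq: "I = UNIV - {v}" by blast
  have indep: "q = 0" if q: "q \<in> polys_in J" "eval_mpoly rconst g q = 0"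
    and J: "inj_on g J" "alg_indep (g ` J)" for q J
  proof -
    let ?q = "eval_mpoly const (\<lambda>v. Var (g v)) q"
    have "?q \<in> polys_in (g ` J)"
      using q(1) by (rule polys_in_eval) (simp add: polys_in_Var)
    moreover have "eval_mpoly rconst (\<lambda>x. x) ?q = 0"
      using q(2) by (simp add: eval_rename)
    ultimately have "?q = 0" using J(2) by (auto simp: alg_indep_altdef)
    moreover have "eval_mpoly const (\<lambda>x. Var (inv_into J g x)) ?q = eval_mpoly const Var q"
      unfolding const.eval_substitute using q(1) J(1) by (intro eval_cong_polys_in) auto
    ultimately show ?thesis by (simp add: eval_Var_id)
  qed
  have "\<exists>p. p \<noteq> 0 \<and> eval_mpoly rconst g p = 0"
  proof (cases "g v \<in> G")
    case True
    then obtain l where l: "l \<noteq> v" "g v = g l" using I I_eq by auto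
    have "Var v - Var l \<noteq> (0 :: ('n, 'k) mpoly)"
    proof
      assume "Var v - Var l = (0 :: ('n, 'k) mpoly)"
      then have "single v 1 = single l (1::nat)"
        unfolding Var_def by (metis eq_iff_diff_eq_0 keys_single singleton_inject zero_neq_one)
      then show False using l(1) by (metis keys_single singleton_inject zero_neq_one)
    qed
    moreover have "eval_mpoly rconst g (Var v - Var l) = 0"
      using l by (simp add: rconst.eval_diff)
    ultimately show ?thesis by blast
  next
    case False
    have ins: "insert (g v) G = range g"
      using I I_eq by auto
    have inj: "inj g"
    proof -
      have "inj_on g (insert v I)"
        unfolding inj_on_insert using I False by blast
      then show ?thesis using I_eq by (simp add: insert_absorb insert_UNIV)
    qed
    obtain q where q: "q \<in> polys_in (range g)" "eval_mpoly rconst (\<lambda>x. x) q = 0" "q \<noteq> 0"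
      using G_ins[of "g v"] False ins by (auto simp: alg_indep_altdef)
    define p where "p = eval_mpoly const (\<lambda>x. Var (inv g x)) q"
    have "eval_mpoly rconst g p = eval_mpoly rconst (\<lambda>x. x) q"
      unfolding p_def eval_rename using q(1) by (rule eval_cong_polys_in) (auto simp: f_inv_into_f)
    moreover have "eval_mpoly const (\<lambda>v. Var (g v)) p = eval_mpoly const Var q"
      unfolding p_def const.eval_substitute using q(1)
      by (intro eval_cong_polys_in) (auto simp: f_inv_into_f)
    then have "p \<noteq> 0" using q(3) by (auto simp: eval_Var_id)
    ultimately show ?thesis using q(2) by auto
  qed
  then show ?thesis
    using that[of _ v] indep[of _ I] I G(2) I_eq by blast
qed

section \<open>Jacobian determinants\<close>

definition jacobian :: "('n::finite \<Rightarrow> ('n, 'k::comm_ring_1) mpoly) \<Rightarrow> ('n, 'k) mpoly ^ 'n ^ 'n"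
  where "jacobian g = (\<chi> l m. pderiv_var m (g l))"

lemma det_replace_row:
  fixes A :: "'a::comm_ring_1 ^ 'n ^ 'n"
  shows "det (\<chi> l. if l = i then \<Sum>m\<in>UNIV. v m *s A $ m else A $ l) = v i * det A"
proof -
  have "det (\<chi> l. if l = i then \<Sum>m\<in>UNIV. v m *s A $ m else A $ l) =
      (\<Sum>m\<in>UNIV. det (\<chi> l. if l = i then v m *s A $ m else A $ l))"
    using det_linear_row_sum[where S=UNIV and k=i and a="\<lambda>_ m. v m *s A $ m" and c="\<lambda>l. A $ l"]
    by simp
  also have "\<dots> = (\<Sum>m\<in>UNIV. v m * det (\<chi> l. if l = i then A $ m else A $ l))"
    by (simp add: det_row_mul)
  also have "\<dots> = (\<Sum>m\<in>UNIV. if m = i then v i * det A else 0)"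
  proof (rule sum.cong, rule refl)
    fix m
    have "(\<chi> l. if l = i then A $ i else A $ l) = A"
      by (simp add: vec_eq_iff)
    moreover have "det (\<chi> l. if l = i then A $ m else A $ l) = 0" if "m \<noteq> i"
      using that by (intro det_identical_rows[of m i]) (simp_all add: row_def vec_eq_iff)
    ultimately show "v m * det (\<chi> l. if l = i then A $ m else A $ l) =
        (if m = i then v i * det A else 0)"
      by auto
  qed
  finally show ?thesis by simp
qed

text \<open>
  By the chain rule the new row is the combination of the old rows with coefficients
  \<open>\<partial>\<^sub>l p\<close> evaluated at \<open>g\<close>; only the coefficient of the row \<open>i\<close> survives in the determinant.
\<close>

lemma det_jacobian_replace:
  fixes g :: "'n::finite \<Rightarrow> ('n, 'k::comm_ring_1) mpoly"
  shows "det (jacobian (g(i := eval_mpoly const g p))) =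
    eval_mpoly const g (pderiv_var i p) * det (jacobian g)"
proof -
  let ?v = "\<lambda>l. eval_mpoly const g (pderiv_var l p)"
  have "jacobian (g(i := eval_mpoly const g p)) =
      (\<chi> l. if l = i then \<Sum>m\<in>UNIV. ?v m *s jacobian g $ m else jacobian g $ l)"
    by (simp add: vec_eq_iff jacobian_def pderiv_var_eval)
  then show ?thesis by (simp only: det_replace_row)
qed

text \<open>
  By the chain rule the Jacobian matrix has a left inverse.
\<close>

lemma det_jacobian_unit:
  fixes g :: "'n::finite \<Rightarrow> ('n, 'k::comm_ring_1) mpoly"
  assumes "\<And>j. eval_mpoly const g (P j) = Var j"
  shows "det (jacobian g) dvd 1"
proof -
  have "(\<chi> j l. eval_mpoly const g (pderiv_var l (P j))) ** jacobian g = mat 1"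
    by (simp add: vec_eq_iff matrix_matrix_mult_def jacobian_def mat_def
        pderiv_var_eval[symmetric] assms pderiv_var_Var)
  then have "det (\<chi> j l. eval_mpoly const g (pderiv_var l (P j))) * det (jacobian g) = 1"
    by (metis det_I det_mul)
  then show ?thesis by (metis dvd_triv_right)
qed

lemma det_jacobian_zero:
  fixes g :: "'n::finite \<Rightarrow> ('n, 'k::comm_ring_1) mpoly"
  assumes "g i = 0"
  shows "det (jacobian g) = 0"
proof -
  have eq: "jacobian g = (\<chi> l. if l = i then 0 else jacobian g $ l)"
    using assms by (simp add: vec_eq_iff jacobian_def)
  show ?thesis by (subst eq) (rule det_row_0)
qed

lemma deg_le_det_jacobian:
  fixes g :: "'n::finite \<Rightarrow> ('n, 'k::comm_ring_1) mpoly"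
  assumes "\<And>l. deg_le w (d l) (g l)"
  shows "deg_le w (sum d UNIV - sum w UNIV) (det (jacobian g))"
  unfolding det_def
proof (rule deg_le_sum)
  fix p assume "p \<in> {p. p permutes (UNIV :: 'n set)}"
  then have p: "p permutes UNIV" by simp
  let ?t = "\<Prod>l\<in>UNIV. jacobian g $ l $ p l"
  have "deg_le w (\<Sum>l\<in>UNIV. d l - w (p l)) ?t"
    using assms by (intro deg_le_prod) (simp add: jacobian_def deg_le_pderiv_var)
  moreover have "(\<Sum>l\<in>UNIV. d l - w (p l)) = sum d UNIV - sum w UNIV"
    using sum.permute[OF p, of w] by (simp add: sum_subtractf o_def)
  ultimately have "deg_le w (sum d UNIV - sum w UNIV) ?t" by simp
  then show "deg_le w (sum d UNIV - sum w UNIV) (of_int (sign p) * ?t)"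
    by (cases "evenperm p") (simp_all add: sign_def deg_le_uminus)
qed

text \<open>
  Compare the degree bound for the Jacobian determinant of \<open>f\<close> with its entry \<open>i\<close> replaced by the value
  of \<open>p\<close> with the formula \<open>det_jacobian_replace\<close>, in which the Jacobian determinant of \<open>f\<close> is a unit, so of
  degree zero.
\<close>

lemma deg_le_eval_pderiv_var:
  fixes f :: "'n::{finite,linorder} \<Rightarrow> ('n, 'k::field) mpoly"
    and w :: "'n \<Rightarrow> 'g::linordered_ab_group_add"
  assumes w: "\<And>i. 0 \<le> w i" and P: "\<And>j. eval_mpoly const f (P j) = Var j"
    and d: "\<And>l. deg_le w (d l) (f l)" and p: "deg_le w \<delta> (eval_mpoly const f p)"
  shows "deg_le w (\<delta> + (sum d UNIV - sum w UNIV - d i)) (eval_mpoly const f (pderiv_var i p))"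
proof -
  let ?q = "eval_mpoly const f (pderiv_var i p)" and ?J = "det (jacobian f)"
  let ?b = "\<delta> + (sum d UNIV - sum w UNIV - d i)"
  have J: "?J dvd 1" using det_jacobian_unit P by blast
  then have "?J \<noteq> 0" by auto
  have "sum (d(i := \<delta>)) UNIV = \<delta> + sum d (UNIV - {i})"
    using sum.remove[of UNIV i "d(i := \<delta>)"] by simp
  then have sum_upd: "sum (d(i := \<delta>)) UNIV - sum w UNIV = ?b"
    using sum.remove[of UNIV i d] by simp
  have "deg_le w (sum (d(i := \<delta>)) UNIV - sum w UNIV) (det (jacobian (f(i := eval_mpoly const f p))))"
    using d p by (intro deg_le_det_jacobian) simp
  then have "deg_le w ?b (?q * ?J)"
    unfolding sum_upd det_jacobian_replace .
  show "deg_le w ?b ?q"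
  proof (cases "?q = 0")
    case False
    then have "wdeg w (?q * ?J) = wdeg w ?q"
      using wdeg_mult[OF False \<open>?J \<noteq> 0\<close>, of w] wdeg_unit[OF w J] by simp
    then show ?thesis
      using \<open>deg_le w ?b (?q * ?J)\<close> False \<open>?J \<noteq> 0\<close> by (metis no_zero_divisors wdeg_le_iff)
  qed simp
qed

section \<open>Derivatives modulo a polynomial\<close>

lemma const_if_pderiv_var_0:
  fixes p :: "('v, 'k::field_char_0) mpoly"
  assumes "\<And>i. pderiv_var i p = 0"
  shows "p = const (lookup p 0)"
proof -
  have "b = 0" if "b \<in> keys p" for b
  proof (rule ccontr)
    assume "b \<noteq> 0"
    then obtain i where i: "lookup b i \<noteq> 0"
      by (auto simp: poly_mapping_eq_iff fun_eq_iff)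
    have "b - single i 1 + single i 1 = b"
      using i by (intro poly_mapping_eqI) (auto simp: lookup_add lookup_minus lookup_single when_def)
    moreover have "lookup (pderiv_var i p) (b - single i 1) = 0"
      using assms by simp
    ultimately have "lookup p b = 0"
      unfolding lookup_pderiv_var by (metis mult_eq_0_iff nat.simps(3) of_nat_eq_0_iff)
    with that show False by (simp add: in_keys_iff)
  qed
  then show ?thesis
    by (intro const_if_keys) blast
qed

lemma not_dvd_pderiv_var:
  fixes p :: "('n::{finite,linorder}, 'k::field) mpoly"
  assumes "pderiv_var i p \<noteq> 0"
  shows "\<not> p dvd pderiv_var i p"
proof
  assume "p dvd pderiv_var i p"
  then obtain q where q: "pderiv_var i p = p * q" by blast
  then have nz: "p \<noteq> 0" "q \<noteq> 0" using assms by auto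
  have "total_degree (pderiv_var i p) \<le> total_degree p - 1"
    unfolding wdeg_le_iff[OF assms] using deg_le_pderiv_var[OF deg_le_wdeg, of "\<lambda>_. 1" p i] by simp
  moreover have "total_degree (pderiv_var i p) = total_degree p + total_degree q"
    using nz by (simp add: q wdeg_mult)
  ultimately show False
    using total_degree_nonneg[OF nz(2)] by simp
qed

lemma pderiv_var_power:
  fixes p :: "('v, 'k::comm_ring_1) mpoly"
  shows "pderiv_var i (p ^ Suc m) = of_nat (Suc m) * p ^ m * pderiv_var i p"
  by (induction m) (simp_all add: pderiv_var_mult algebra_simps)

text \<open>
  Each of the \<open>m\<close> derivatives must hit a different factor \<open>Q\<close>; all other terms keep a factor \<open>Q\<close>.
\<close>

lemma iterated_pderiv_var_power:
  fixes Q R :: "('v, 'k::comm_ring_1) mpoly"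
  shows "\<exists>T. (pderiv_var i ^^ m) (Q ^ m * R) = of_nat (fact m) * pderiv_var i Q ^ m * R + Q * T"
proof (induction m arbitrary: R)
  case 0
  show ?case by (intro exI[of _ 0]) simp
next
  case (Suc m)
  let ?R = "of_nat (Suc m) * pderiv_var i Q * R + Q * pderiv_var i R"
  have "pderiv_var i (Q ^ Suc m * R) = Q ^ m * ?R"
    unfolding pderiv_var_mult pderiv_var_power by (simp add: algebra_simps)
  then have "(pderiv_var i ^^ Suc m) (Q ^ Suc m * R) = (pderiv_var i ^^ m) (Q ^ m * ?R)"
    by (simp only: funpow_Suc_right o_apply)
  moreover obtain T where
    "(pderiv_var i ^^ m) (Q ^ m * ?R) = of_nat (fact m) * pderiv_var i Q ^ m * ?R + Q * T"
    using Suc.IH by blast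
  ultimately have "(pderiv_var i ^^ Suc m) (Q ^ Suc m * R) =
      of_nat (fact (Suc m)) * pderiv_var i Q ^ Suc m * R +
      Q * (of_nat (fact m) * pderiv_var i Q ^ m * pderiv_var i R + T)"
    by (simp add: algebra_simps)
  then show ?case by blast
qed

lemma ex_power_factor:
  fixes F Q :: "('n::{finite,linorder}, 'k::field) mpoly"
  assumes "F \<noteq> 0" "\<not> Q dvd 1"
  shows "\<exists>m R. F = Q ^ m * R \<and> \<not> Q dvd R"
  using assms(1)
proof (induction "nat (total_degree F)" arbitrary: F rule: less_induct)
  case less
  show ?case
  proof (cases "Q dvd F")
    case True
    then obtain G where G: "F = Q * G" by blast
    then have nz: "Q \<noteq> 0" "G \<noteq> 0" using less.prems by auto
    then have "nat (total_degree G) < nat (total_degree F)"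
      using total_degree_nonunit[of Q] total_degree_nonneg[of G] assms(2) by (simp add: G wdeg_mult)
    then obtain m R where "G = Q ^ m * R" "\<not> Q dvd R"
      using less.hyps nz by blast
    then have "F = Q ^ Suc m * R \<and> \<not> Q dvd R"
      by (simp add: G mult.assoc)
    then show ?thesis by blast
  next
    case False
    then have "F = Q ^ 0 * F \<and> \<not> Q dvd F" by simp
    then show ?thesis by blast
  qed
qed

section \<open>The inequality\<close>

lemma subalgebra_hull_surj:
  fixes f :: "'n::finite \<Rightarrow> ('n, 'k::comm_ring_1) mpoly"
  assumes "is_subalgebra hull (range f) = UNIV"
  shows "\<exists>p. eval_mpoly const f p = q"
proof -
  let ?A = "range (eval_mpoly const f)"
  have "f i \<in> ?A" for i
    by (metis const.eval_Var rangeI)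
  moreover have "is_subalgebra ?A"
    unfolding is_subalgebra_def
  proof (intro conjI allI ballI)
    show "const c \<in> ?A" for c
      by (rule image_eqI[of _ _ "const c"]) simp_all
    fix p q assume "p \<in> ?A" "q \<in> ?A"
    then obtain p' q' where pq: "p = eval_mpoly const f p'" "q = eval_mpoly const f q'"
      by blast
    then show "p + q \<in> ?A" "p * q \<in> ?A"
      by (auto simp flip: const.eval_add const.eval_mult)
  qed
  ultimately have "is_subalgebra hull (range f) \<subseteq> ?A"
    by (intro hull_minimal) auto
  then show ?thesis using assms by (metis UNIV_I rangeE subsetD)
qed

lemma to_fract_eval:
  fixes g :: "'m \<Rightarrow> ('n::{finite,linorder}, 'k::field) mpoly"
  shows "to_fract (eval_mpoly const g p) = eval_mpoly rconst (\<lambda>i. to_fract (g i)) p"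
proof (induction p rule: mpoly_induct)
  case (const c)
  show ?case unfolding const.eval_const rconst.eval_const by (simp add: rconst_def)
qed (simp_all add: const.eval_add const.eval_mult rconst.eval_add rconst.eval_mult)

text \<open>
  The kernel is the set of relations between the leading forms, taken in the field of fractions, so
  \<open>trdeg_relations\<close> supplies the hypotheses of \<open>prime_ideal_principal\<close>.
\<close>

lemma kernel_generator:
  fixes f :: "'n::{finite,linorder} \<Rightarrow> ('n, 'k::field) mpoly"
    and w :: "'n \<Rightarrow> 'g::linordered_ab_group_add"
  assumes "has_trdeg (is_subfield hull (range (\<lambda>i. to_fract (lead_form w (f i))))) (CARD('n) - 1)"
  shows "kernel_generator w f \<noteq> 0"
    and "lead_hom w f p = 0 \<longleftrightarrow> kernel_generator w f dvd p"
proof -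
  let ?K = "{p. lead_hom w f p = 0}"
  have ev: "eval_mpoly rconst (\<lambda>i. to_fract (lead_form w (f i))) p = 0 \<longleftrightarrow> lead_hom w f p = 0" for p
    by (simp add: lead_hom_def flip: to_fract_eval)
  obtain g v where "g \<noteq> 0" "lead_hom w f g = 0"
    and "\<And>q. q \<in> polys_in (UNIV - {v}) \<Longrightarrow> lead_hom w f q = 0 \<Longrightarrow> q = 0"
    using trdeg_relations[OF assms] unfolding ev by blast
  then have "\<exists>Q. Q \<noteq> 0 \<and> ?K = {Q * p | p. True}"
    by (intro prime_ideal_principal[of _ g v])
      (auto simp: lead_hom_def const.eval_diff const.eval_mult)
  then have "kernel_generator w f \<noteq> 0 \<and> ?K = {kernel_generator w f * p | p. True}"
    unfolding kernel_generator_def by (rule someI_ex)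
  then show "kernel_generator w f \<noteq> 0" "lead_hom w f p = 0 \<longleftrightarrow> kernel_generator w f dvd p"
    by (auto simp: dvd_def)
qed

lemma wdeg_power:
  fixes p :: "('n::{finite,linorder}, 'k::idom) mpoly"
  assumes "p \<noteq> 0"
  shows "wdeg w (p ^ m) = (\<Sum>_<m. wdeg w p)"
proof (induction m)
  case 0
  show ?case using wdeg_const[of "1::'k" w] by simp
qed (use assms in \<open>simp add: wdeg_mult add.commute\<close>)

text \<open>
  Cancelling the multiple \<open>m\<close>, in a group without division: if \<open>M + c < D\<close>, then \<open>M \<le> D\<close>, so each
  further summand preserves the strict inequality.
\<close>

lemma le_if_multiples_le:
  fixes D M c :: "'g::linordered_ab_group_add" and m :: nat
  assumes "0 < m" "0 \<le> c" "(\<Sum>_<m. D) \<le> c + (\<Sum>_<m. M)"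
  shows "D \<le> M + c"
proof (rule ccontr)
  assume "\<not> D \<le> M + c"
  then have less: "M + c < D" by simp
  then have "M \<le> D" using assms(2) by (meson le_add_same_cancel1 less_imp_le order_trans)
  have "c + (\<Sum>_<Suc k. M) < (\<Sum>_<Suc k. D)" for k
  proof (induction k)
    case 0
    show ?case using less by (simp add: add.commute)
  next
    case (Suc k)
    then show ?case using add_less_le_mono[OF Suc \<open>M \<le> D\<close>] by (simp add: add.assoc)
  qed
  from this[of "m - 1"] show False using assms(1,3) by simp
qed

theorem theorem4p3:
  fixes f :: "'n::{finite,linorder} \<Rightarrow> ('n, 'k::field_char_0) mpoly"
    and w :: "'n \<Rightarrow> 'g::linordered_ab_group_add"
  assumes "is_subalgebra hull (f ` UNIV) = UNIV"
    and "\<forall>i. w i \<ge> 0"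
    and "has_trdeg (is_subfield hull ((\<lambda>i. to_fract (lead_form w (f i))) ` UNIV)) (CARD('n) - 1)"
  shows "(\<Sum>i\<in>UNIV. wdeg w (f i)) \<ge> Delta w f + (\<Sum>i\<in>UNIV. w i) - Max (w ` UNIV)"
proof -
  define d where "d = (\<lambda>i. wdeg w (f i))"
  define M where "M = sum d UNIV - sum w UNIV"
  define Q where "Q = kernel_generator w f"
  let ?\<phi> = "eval_mpoly const f" and ?h = "lead_hom w f"
  have w: "\<And>i. 0 \<le> w i" using assms(2) by simp
  have "\<exists>P. \<forall>j. ?\<phi> (P j) = Var j"
    by (intro choice allI subalgebra_hull_surj[OF assms(1)])
  then obtain P where P: "\<And>j. ?\<phi> (P j) = Var j" by blast
  have f_nz: "f i \<noteq> 0" for i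
    using det_jacobian_unit[of f P] P det_jacobian_zero[of f i] by auto
  have d: "deg_le w (d l) (f l)" "0 \<le> d l" for l
    using wdeg_nonneg[OF w f_nz] by (simp_all add: d_def deg_le_wdeg)
  have lead_hom: "?h = eval_mpoly const (\<lambda>i. component w (d i) (f i))"
    by (simp add: fun_eq_iff lead_hom_def lead_form_def d_def)
  note lead = component_eval(2)[of w d f, OF d(1), folded lead_hom]
  have Q: "Q \<noteq> 0" "?h p = 0 \<longleftrightarrow> Q dvd p" for p
    unfolding Q_def using kernel_generator[OF assms(3)] by auto
  have Q_nonunit: "\<not> Q dvd 1"
    using Q(2)[of 1] by (simp add: lead_hom)
  have "\<exists>i. pderiv_var i Q \<noteq> 0"
  proof (rule ccontr)
    assume "\<nexists>i. pderiv_var i Q \<noteq> 0"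
    then have "Q = const (lookup Q 0)" by (intro const_if_pderiv_var_0) simp
    then show False using const_unit Q_nonunit Q(1) by (metis const_0)
  qed
  then obtain i where "pderiv_var i Q \<noteq> 0" by blast
  then have dQ: "?h (pderiv_var i Q) \<noteq> 0"
    using Q(2) not_dvd_pderiv_var by blast
  have wdeg_Var: "deg_le w (w j) (Var j)" "component w (w j) (Var j) = Var j" for j
    by (simp_all add: Var_def deg_le_single component_single)
  \<comment> \<open>otherwise the leading forms would generate all variables, leaving no room for \<open>Q\<close>\<close>
  have "\<exists>j. \<not> deg_le d (w j) (P j)"
  proof (rule ccontr)
    assume "\<nexists>j. \<not> deg_le d (w j) (P j)"
    then have "?h (component d (w j) (P j)) = Var j" for j
      using lead[of "w j" "P j"] by (simp add: P wdeg_Var)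
    then have unit: "det (jacobian (\<lambda>i. component w (d i) (f i))) dvd 1"
      unfolding lead_hom by (rule det_jacobian_unit)
    have "det (jacobian ((\<lambda>i. component w (d i) (f i))(i := ?h Q))) =
        ?h (pderiv_var i Q) * det (jacobian (\<lambda>i. component w (d i) (f i)))"
      unfolding lead_hom by (rule det_jacobian_replace)
    moreover have "?h Q = 0" using Q(2) by simp
    ultimately have "?h (pderiv_var i Q) * det (jacobian (\<lambda>i. component w (d i) (f i))) = 0"
      using det_jacobian_zero[of "(\<lambda>i. component w (d i) (f i))(i := 0)" i] by simp
    then show False using dQ unit by auto
  qed
  then obtain j where j: "\<not> deg_le d (w j) (P j)" by blast
  define e where "e = wdeg d (P j)"
  define F where "F = component d e (P j)"
  have P_nz: "P j \<noteq> 0" using j by auto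
  then have "w j < e" using j wdeg_le_iff[OF P_nz, of d "w j"] by (simp add: e_def)
  have F_nz: "F \<noteq> 0"
    using lead_form_nonzero[OF P_nz, of d] by (simp add: F_def e_def lead_form_def)
  have "?h F = component w e (Var j)"
    using lead[of e "P j"] by (simp add: P F_def e_def deg_le_wdeg)
  also have "\<dots> = 0"
    using component_eq_0[OF wdeg_Var(1) \<open>w j < e\<close>] .
  finally have "Q dvd F" using Q(2) by blast
  obtain m R where FR: "F = Q ^ m * R" and "\<not> Q dvd R"
    using ex_power_factor[OF F_nz Q_nonunit] by blast
  have "0 < m" using \<open>Q dvd F\<close> \<open>\<not> Q dvd R\<close> FR by (cases "m = 0") auto
  have R_nz: "R \<noteq> 0" using F_nz FR by auto
  \<comment> \<open>lower estimate: the leading form of the iterated derivative survives substitution\<close>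
  have "deg_le d (e - (\<Sum>_<m. d i)) ((pderiv_var i ^^ m) (P j)) \<and>
      component d (e - (\<Sum>_<m. d i)) ((pderiv_var i ^^ m) (P j)) = (pderiv_var i ^^ m) F" for m
  proof (induction m)
    case 0
    show ?case by (simp add: F_def e_def deg_le_wdeg)
  next
    case (Suc m)
    then show ?case
      using deg_le_pderiv_var[of d "e - (\<Sum>_<m. d i)" "(pderiv_var i ^^ m) (P j)" i]
        component_pderiv_var[of d "e - (\<Sum>_<m. d i)" i "(pderiv_var i ^^ m) (P j)"]
      by (simp add: diff_diff_add)
  qed
  then have "component w (e - (\<Sum>_<m. d i)) (?\<phi> ((pderiv_var i ^^ m) (P j))) =
      ?h ((pderiv_var i ^^ m) F)"
    by (simp add: lead)
  moreover have "?h ((pderiv_var i ^^ m) F) \<noteq> 0"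
  proof -
    obtain T where T: "(pderiv_var i ^^ m) F = of_nat (fact m) * pderiv_var i Q ^ m * R + Q * T"
      using iterated_pderiv_var_power[of m i Q R] unfolding FR by blast
    have "?h (Q * T) = 0" using Q(2) by simp
    moreover have "?h (of_nat (fact m)) = const (of_nat (fact m))"
      by (metis const.eval_const const_def lead_hom single_of_nat)
    ultimately have "?h ((pderiv_var i ^^ m) F) =
        const (of_nat (fact m)) * ?h (pderiv_var i Q) ^ m * ?h R"
      unfolding T by (simp add: lead_hom const.eval_add const.eval_mult const.eval_power)
    then show ?thesis
      using dQ Q(2)[of R] \<open>\<not> Q dvd R\<close> by simp
  qed
  \<comment> \<open>upper estimate, from \<open>\<phi> P\<^sub>j = x\<^sub>j\<close> of degree \<open>w j\<close>\<close>
  moreover have "deg_le w (w j + (\<Sum>_<m. M - d i)) (?\<phi> ((pderiv_var i ^^ m) (P j)))" for m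
  proof (induction m)
    case 0
    show ?case by (simp add: P wdeg_Var)
  next
    case (Suc m)
    then show ?case
      using deg_le_eval_pderiv_var[OF w P d(1) Suc, where i=i] by (simp add: M_def add.assoc)
  qed
  ultimately have "e - (\<Sum>_<m. d i) \<le> w j + (\<Sum>_<m. M - d i)"
    by (metis deg_le_component_imp_le)
  then have "e \<le> w j + (\<Sum>_<m. M)"
    by (simp add: sum_subtractf algebra_simps)
  have "(\<Sum>_<m. wdeg d Q) \<le> e"
  proof -
    have "deg_le d e F"
      by (auto simp: F_def deg_le_def in_keys_iff lookup_component split: if_splits)
    moreover have "component d e F = F"
      by (rule poly_mapping_eqI) (simp add: F_def lookup_component)
    ultimately have "e = wdeg d F"
      using F_nz by (metis wdeg_eqI)
    also have "\<dots> = (\<Sum>_<m. wdeg d Q) + wdeg d R"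
      using Q(1) R_nz by (simp add: FR wdeg_mult wdeg_power)
    finally show ?thesis using wdeg_nonneg[of d R] d(2) R_nz by simp
  qed
  also note \<open>e \<le> w j + (\<Sum>_<m. M)\<close>
  finally have "wdeg d Q \<le> M + w j"
    by (rule le_if_multiples_le[OF \<open>0 < m\<close> w])
  also have "\<dots> \<le> M + Max (w ` UNIV)"
    by simp
  finally have "Delta w f \<le> M + Max (w ` UNIV)"
    by (simp add: Delta_def Q_def d_def)
  then show ?thesis
    by (simp add: M_def d_def algebra_simps)
qed

end
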